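(* Consider the linear system $x_{t+1}=Ax_t+Bu_t+w_t$, $y_t=Cx_t+Du_t$, $t=0,1,\dots$, with $A\in\mathbb{R}^{n\times n}$, $B\in\mathbb{R}^{n\times m}$, $C\in\mathbb{R}^{r\times n}$, $D\in\mathbb{R}^{r\times m}$, and let $k\ge1$ be an integer. Suppose the attacks $w_t$ satisfy the probabilistic attack assumption (stated in the context) with probability $p<\frac{1}{4k-2}$, and let $u_t\sim N(0,\gamma^2I_m)$ for all $t$, where $\gamma>0$. Let $q=1-(1-p)^{2k-1}$. Given $\delta\in(0,1]$, when $$T\ge\Theta\left(\frac{k}{(1-2q)^2}\left[km\log\Bigl(\frac{km}{1-2q}\Bigr)+\log\Bigl(\frac r\delta\Bigr)\right]\right),$$ we have, with probability at least $1-\delta$, $$\sum_{t=2k-1}^{T+2k-2}\mathbb{I}\{v_t^i=0\}\cdot|s^T\mathbf{U}_t^{(k)}|\ \ge\ \Theta(\gamma(1-2q)T)>0\qquad\text{for all } s\in\mathbb{S}^{2km-1}\text{ and all } i\in\{1,\dots,r\}.$$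
   Context: $x_t\in\mathbb{R}^n$ is the state, $u_t\in\mathbb{R}^m$ the control input, $y_t\in\mathbb{R}^r$ the observation, and $w_t\in\mathbb{R}^n$ the attack at time $t$; $w_t=0$ when there is no attack, and at attack times $w_t$ may be chosen arbitrarily by an adversary. Let $\mathcal{F}_t=\bm{\sigma}\{x_0,w_0,\dots,w_{t-1}\}$ be the $\sigma$-algebra generated by these variables. Probabilistic attack assumption: conditioned on $\mathcal{F}_t$, $w_t$ is an attack with probability $p<\frac1{4k-2}$, meaning that there exists a sequence $(\xi_t)_{t\ge0}$ of independent Bernoulli$(p)$ variables, each $\xi_t$ independent of $\mathcal{F}_t$, such that $\{\xi_t=0\}\subseteq\{w_t=0\}$ for all $t\ge0$. The inputs $u_0,u_1,\dots$ are mutually independent, and the sequence $(u_t)$ is independent of the sequence $(\xi_t)$. For $t\ge2k-1$: $\mathbf{U}_t^{(k)}=[u_t^T\ u_{t-1}^T\cdots u_{t-2k+1}^T]^T\in\mathbb{R}^{2km}$, $v_t=\sum_{j=0}^{2k-2}CA^jw_{t-1-j}\in\mathbb{R}^r$, and $v_t^i$ is the $i$-th entry of $v_t$. For an event $E$, $\mathbb{I}\{E\}$ equals $1$ if $E$ occurs and $-1$ otherwise. $\mathbb{S}^{N-1}=\{y\in\mathbb{R}^N:\|y\|_2=1\}$. $\Theta(\cdot)$ is big-$\Theta$ notation: "$Y\ge\Theta(X)$" means $Y\ge cX$ for some suitable constant $c>0$ not depending on the quantities displayed inside the $\Theta$-expressions of the claim, nor on $s$, $i$.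
   Formalization: When km=1, T must also be at least an absolute constant T0; without this the claim fails (k=m=n=r=1, p=0, no attacks, T=1, δ near 1: some unit s is orthogonal to the only stacked input, so the sum is 0). *)

theory Defs
  imports "HOL-Probability.Probability" "Jordan_Normal_Form.Matrix"
begin

unbundle no vec_syntax
no_notation inner (infix \<open>\<bullet>\<close> 70)

text \<open>
  All dimensions are natural numbers and vectors and matrices are those of Jordan_Normal_Form,
  so that constants can be chosen uniformly in the dimensions.
  The Borel sigma-algebra on d-dimensional real vectors is transported from the product
  sigma-algebra along the coordinate map.
\<close>

definition vec_borel :: "nat \<Rightarrow> real vec measure" where
  "vec_borel d =
     vimage_algebra (carrier_vec d) (\<lambda>v. \<lambda>i\<in>{..<d}. v $ i) (Pi\<^sub>M {..<d} (\<lambda>_. borel))"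

text \<open>
  The law \<open>N(0, \<sigma>\<^sup>2 I\<^sub>d)\<close>; the second argument of \<^const>\<open>normal_density\<close> is the standard deviation.
\<close>

definition isotropic_gaussian :: "nat \<Rightarrow> real \<Rightarrow> real vec measure" where
  "isotropic_gaussian d \<sigma> =
     distr (Pi\<^sub>M {..<d} (\<lambda>_. density lborel (\<lambda>z. ennreal (normal_density 0 \<sigma> z)))) (vec_borel d) (vec d)"

text \<open>The sigma-algebra generated by \<open>x 0, w 0, \<dots>, w (t - 1)\<close>.\<close>

definition history ::
  "'a measure \<Rightarrow> nat \<Rightarrow> (nat \<Rightarrow> 'a \<Rightarrow> real vec) \<Rightarrow> (nat \<Rightarrow> 'a \<Rightarrow> real vec) \<Rightarrow> nat \<Rightarrow> 'a set set" where
  "history M n x w t = sigma_sets (space M)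
     ({x 0 -` S \<inter> space M | S. S \<in> sets (vec_borel n)} \<union>
      (\<Union>j<t. {w j -` S \<inter> space M | S. S \<in> sets (vec_borel n)}))"

text \<open>
  The Bernoulli variables \<open>\<xi> t\<close> are Boolean, \<^const>\<open>False\<close> standing for 0. Only the initial state,
  the inputs and the attacks need measurability assumptions (that of the inputs is part of
  \<open>inputs_indep\<close>); the attacks are constrained only by \<open>no_attack\<close> and
  \<open>indicator_indep_history\<close>, and may otherwise depend on all other variables.
\<close>

locale attacked_system = prob_space M
  for M :: "'a measure" +
  fixes n m r :: nat
    and A B C D :: "real mat"
    and p \<gamma> :: real
    and x u w y :: "nat \<Rightarrow> 'a \<Rightarrow> real vec"
    and \<xi> :: "nat \<Rightarrow> 'a \<Rightarrow> bool"
  assumes dims: "1 \<le> n" "1 \<le> m" "1 \<le> r"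
    and A: "A \<in> carrier_mat n n"
    and B: "B \<in> carrier_mat n m"
    and C: "C \<in> carrier_mat r n"
    and D: "D \<in> carrier_mat r m"
    and initial_state: "x 0 \<in> measurable M (vec_borel n)"
    and attacks: "\<And>t. w t \<in> measurable M (vec_borel n)"
    and state_eq: "\<And>t \<omega>. \<omega> \<in> space M \<Longrightarrow>
      x (Suc t) \<omega> = A *\<^sub>v x t \<omega> + B *\<^sub>v u t \<omega> + w t \<omega>"
    and output_eq: "\<And>t \<omega>. \<omega> \<in> space M \<Longrightarrow> y t \<omega> = C *\<^sub>v x t \<omega> + D *\<^sub>v u t \<omega>"
    and p_prob: "0 \<le> p" "p \<le> 1"
    and indicators_indep: "indep_vars (\<lambda>_. count_space UNIV) \<xi> UNIV"
    and indicator_law: "\<And>t. distr M (count_space UNIV) (\<xi> t) = measure_pmf (bernoulli_pmf p)"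
    and indicator_indep_history: "\<And>t.
      indep_set (sets (vimage_algebra (space M) (\<xi> t) (count_space UNIV))) (history M n x w t)"
    and no_attack: "\<And>t \<omega>. \<omega> \<in> space M \<Longrightarrow> \<not> \<xi> t \<omega> \<Longrightarrow> w t \<omega> = 0\<^sub>v n"
    and \<gamma>_pos: "0 < \<gamma>"
    and input_law: "\<And>t. distr M (vec_borel m) (u t) = isotropic_gaussian m \<gamma>"
    and inputs_indep: "indep_vars (\<lambda>_. vec_borel m) u UNIV"
    and inputs_indep_indicators: "indep_set
      (sets (vimage_algebra (space M) (\<lambda>\<omega> t. u t \<omega>) (Pi\<^sub>M UNIV (\<lambda>_. vec_borel m))))
      (sets (vimage_algebra (space M) (\<lambda>\<omega> t. \<xi> t \<omega>) (Pi\<^sub>M UNIV (\<lambda>_. count_space UNIV))))"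

text \<open>The stacked vector \<open>[u\<^sub>t\<^sup>T u\<^sub>t\<^sub>-\<^sub>1\<^sup>T \<dots> u\<^sub>t\<^sub>-\<^sub>2\<^sub>k\<^sub>+\<^sub>1\<^sup>T]\<^sup>T\<close>, for \<open>t \<ge> 2k - 1\<close>.\<close>

definition stacked_input ::
  "nat \<Rightarrow> nat \<Rightarrow> (nat \<Rightarrow> 'a \<Rightarrow> real vec) \<Rightarrow> nat \<Rightarrow> 'a \<Rightarrow> real vec" where
  "stacked_input m k u t \<omega> = vec (2 * k * m) (\<lambda>l. u (t - l div m) \<omega> $ (l mod m))"

text \<open>Used for \<open>t \<ge> 2k - 1\<close> only, so that the time index does not truncate.\<close>

definition accumulated_attack ::
  "nat \<Rightarrow> real mat \<Rightarrow> real mat \<Rightarrow> nat \<Rightarrow> (nat \<Rightarrow> 'a \<Rightarrow> real vec) \<Rightarrow> nat \<Rightarrow> 'a \<Rightarrow> real vec" where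
  "accumulated_attack r A C k w t \<omega> =
     finsum_vec TYPE(real) r (\<lambda>j. (C * A ^\<^sub>m j) *\<^sub>v w (t - 1 - j) \<omega>) {0..2 * k - 2}"

definition sign_indicator :: "bool \<Rightarrow> real" where
  "sign_indicator E = (if E then 1 else - 1)"

definition unit_sphere :: "nat \<Rightarrow> real vec set" where
  "unit_sphere d = {s \<in> carrier_vec d. L2_set (\<lambda>i. s $ i) {..<d} = 1}"

text \<open>
  A horizon \<open>T\<close> "of order at least \<open>time_bound\<close>" is one with \<open>T \<ge> c * time_bound k m r q \<delta>\<close> for an
  absolute constant \<open>c > 0\<close>. If \<open>k * m \<ge> 2\<close>, the bound is at least a positive absolute constant.
  If \<open>k * m = 1\<close>, it can be arbitrarily close to 0 (\<open>r = 1\<close>, small \<open>q\<close>, \<open>\<delta>\<close> near 1), which would admit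
  \<open>T = 1\<close>; then some unit vector is orthogonal to the only stacked input and no positive lower
  bound can hold. In that case alone \<open>T\<close> must also be at least an absolute constant.
\<close>

definition time_bound :: "nat \<Rightarrow> nat \<Rightarrow> nat \<Rightarrow> real \<Rightarrow> real \<Rightarrow> real" where
  "time_bound k m r q \<delta> =
     real k / (1 - 2 * q)\<^sup>2 *
       (real (k * m) * ln (real (k * m) / (1 - 2 * q)) + ln (real r / \<delta>))"

end

theory Submission
  imports Defs
begin

text \<open>
  Write \<open>\<Delta> = 1 - 2 * q = 2 * (1 - p) ^ (2 * k - 1) - 1\<close>, which is positive because
  \<open>p < 1 / (4 * k - 2)\<close>, and \<open>d = 2 * k * m\<close>. If no indicator \<open>\<xi>\<close> fires in the window
  \<open>t - 2k + 1, \<dots>, t - 1\<close>, then every entry of the accumulated attack at time \<open>t\<close> vanishes. So the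
  sign in the sum is at least the \<^emph>\<open>quiet sign\<close>, which is 1 if the window is free of attacks and
  -1 otherwise. This lower bound no longer mentions the attacks or the coordinate \<open>i\<close>: the
  adversary and the number of outputs drop out, and what is left is a sum
  \<open>G s = (\<Sum>t. \<sigma>\<^sub>t * \<bar>s \<bullet> U\<^sub>t\<bar>)\<close> in which the signs \<open>\<sigma>\<^sub>t\<close> (functions of \<open>\<xi>\<close>, with mean \<open>\<Delta>\<close>)
  are independent of the Gaussian inputs.

  For a fixed direction \<open>s\<close>, \<open>s \<bullet> U\<^sub>t\<close> is normal with standard deviation \<open>\<gamma> * \<parallel>s\<parallel>\<close>, so a summand
  has mean at least \<open>\<gamma> * \<parallel>s\<parallel> * \<Delta> / 2\<close> and an exponential moment of the sub-Gaussian form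
  \<open>exp (- \<theta> * \<Delta> / 2 + O(\<theta>\<^sup>2))\<close> (\<open>signed_abs_normal_mgf\<close>). Summands \<open>2k\<close> steps apart
  depend on disjoint windows and are independent. A Chernoff bound in each of the \<open>2k\<close> residue
  classes and a union bound give \<open>G s > T * \<gamma> * \<parallel>s\<parallel> * \<Delta> / 4\<close> outside an event of probability
  \<open>2k * exp (- c * T * \<Delta>\<^sup>2 / k)\<close> (\<open>signed_sum_lower_tail\<close>).

  To reach all directions at once, the unit sphere is covered by a cubic grid of mesh
  \<open>\<epsilon> = \<Delta> / (96 * d)\<close>, which has at most
  \<open>(288 * d / \<Delta>) ^ d\<close> points. Moving \<open>s\<close> to a grid point changes \<open>G\<close> by at most \<open>\<epsilon>\<close> times the
  sum of the absolute values of all entries of the stacked inputs. With overwhelming probability these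
  entries are at most \<open>3 * \<gamma>\<close> in absolute value on average (\<open>input_mass_upper_tail\<close>). The union bound over
  the grid costs \<open>d * ln (288 * d / \<Delta>)\<close> in the exponent, which is where the logarithm in the
  horizon comes from (\<open>uniform_lower_bound\<close>, \<open>horizon_condition\<close>).

  The event in the theorem quantifies over uncountably many directions. It is measurable because, by
  continuity and homogeneity in \<open>s\<close>, rational directions suffice (\<open>sphere_bound_iff_rational\<close>).
\<close>

section \<open>Exponential moments and Chernoff bounds\<close>

text \<open>
  Keeping the first two terms exact preserves the mean when this is integrated; the remainder only
  has to be integrable.
\<close>

lemma exp_le_quadratic:
  fixes x :: real
  shows "exp x \<le> 1 + x + x\<^sup>2 / 2 * exp \<bar>x\<bar>"
proof -
  obtain t where t: "\<bar>t\<bar> \<le> \<bar>x\<bar>" "exp x = (\<Sum>i<2. x ^ i / fact i) + exp t / fact 2 * x ^ 2"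
    using Maclaurin_exp_le[of x 2] by blast
  have "exp t \<le> exp \<bar>x\<bar>" using t(1) by simp
  then have "exp t / 2 * x\<^sup>2 \<le> exp \<bar>x\<bar> / 2 * x\<^sup>2"
    by (intro mult_right_mono) auto
  then show ?thesis using t(2) by (simp add: numeral_2_eq_2 mult.commute)
qed

lemma square_le_exp:
  fixes x :: real
  assumes "0 \<le> x"
  shows "x\<^sup>2 / 2 \<le> exp x"
proof -
  have "1 + x + x\<^sup>2 / 2 \<le> exp x" using exp_lower_Taylor_quadratic[OF assms] by simp
  then show ?thesis using assms by linarith
qed

context prob_space
begin

text \<open>
  Completing the square: tilting the standard normal density by \<open>exp (c * z)\<close> gives a multiple of the normal density with mean \<open>c\<close>.
\<close>

lemma std_normal_exp:
  assumes Y: "distributed M lborel Y std_normal_density"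
  shows "integrable M (\<lambda>\<omega>. exp (c * Y \<omega>))"
    and "expectation (\<lambda>\<omega>. exp (c * Y \<omega>)) = exp (c\<^sup>2 / 2)"
proof -
  have shift: "std_normal_density z * exp (c * z) = exp (c\<^sup>2 / 2) * normal_density c 1 z" for z
    by (simp add: normal_density_def mult_exp_exp power2_eq_square field_simps
        flip: exp_add)
  have "integrable lborel (\<lambda>z. std_normal_density z * exp (c * z))"
    unfolding shift by (intro integrable_mult_right integrable_normal_density) simp
  then show "integrable M (\<lambda>\<omega>. exp (c * Y \<omega>))"
    using distributed_integrable[OF Y, of "\<lambda>z. exp (c * z)"] by simp
  have "(\<integral>z. std_normal_density z * exp (c * z) \<partial>lborel) = exp (c\<^sup>2 / 2)"
    unfolding shift by simp
  then show "expectation (\<lambda>\<omega>. exp (c * Y \<omega>)) = exp (c\<^sup>2 / 2)"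
    using distributed_integral[OF Y, of "\<lambda>z. exp (c * z)"] by simp
qed

lemma std_normal_exp_abs:
  assumes Y: "distributed M lborel Y std_normal_density"
  shows "integrable M (\<lambda>\<omega>. exp (c * \<bar>Y \<omega>\<bar>))"
    and "expectation (\<lambda>\<omega>. exp (c * \<bar>Y \<omega>\<bar>)) \<le> 2 * exp (c\<^sup>2 / 2)"
proof -
  have [measurable]: "Y \<in> borel_measurable M"
    using distributed_measurable[OF Y] by simp
  note int = std_normal_exp(1)[OF Y, of c] std_normal_exp(1)[OF Y, of "- c"]
  have le: "exp (c * \<bar>y\<bar>) \<le> exp (c * y) + exp (- c * y)" for y
    by (cases "0 \<le> y") (auto simp: abs_if add_increasing add_increasing2)
  show i: "integrable M (\<lambda>\<omega>. exp (c * \<bar>Y \<omega>\<bar>))"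
    by (rule Bochner_Integration.integrable_bound[OF Bochner_Integration.integrable_add[OF int]])
      (use le in \<open>auto intro!: AE_I2 simp: abs_of_nonneg add_nonneg_nonneg\<close>)
  have "expectation (\<lambda>\<omega>. exp (c * \<bar>Y \<omega>\<bar>)) \<le> expectation (\<lambda>\<omega>. exp (c * Y \<omega>) + exp (- c * Y \<omega>))"
    by (intro integral_mono i Bochner_Integration.integrable_add int le)
  also have "\<dots> = 2 * exp (c\<^sup>2 / 2)"
    using Bochner_Integration.integral_add[OF int] std_normal_exp(2)[OF Y, of c]
      std_normal_exp(2)[OF Y, of "- c"] by simp
  finally show "expectation (\<lambda>\<omega>. exp (c * \<bar>Y \<omega>\<bar>)) \<le> 2 * exp (c\<^sup>2 / 2)" .
qed

lemma std_normal_abs: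
  assumes Y: "distributed M lborel Y std_normal_density"
  shows "integrable M (\<lambda>\<omega>. \<bar>Y \<omega>\<bar>)" and "1 / 2 \<le> expectation (\<lambda>\<omega>. \<bar>Y \<omega>\<bar>)"
proof -
  show "integrable M (\<lambda>\<omega>. \<bar>Y \<omega>\<bar>)"
    using distributed_integrable[OF Y, of abs] integrable_std_normal_moment_abs[of 1] by simp
  have "expectation (\<lambda>\<omega>. \<bar>Y \<omega>\<bar>) = sqrt (2 / pi)"
    using distributed_integral[OF Y, of abs] integral_std_normal_moment_abs_odd[of 0] by simp
  moreover have "1 / 2 \<le> sqrt (2 / pi)"
    using pi_less_4 pi_gt_zero by (intro real_le_rsqrt) (auto simp: power2_eq_square field_simps)
  ultimately show "1 / 2 \<le> expectation (\<lambda>\<omega>. \<bar>Y \<omega>\<bar>)" by simp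
qed

text \<open>
  The linear term of the exponential contributes \<open>- \<theta> * E S * E \<bar>Y\<bar>\<close> by independence, and
  \<open>E \<bar>Y\<bar> \<ge> 1 / 2\<close>. The quadratic remainder is at most \<open>\<theta>\<^sup>2 * exp (2 * \<bar>Y\<bar>)\<close>, whose mean is at
  most \<open>2 * exp 2 \<le> 18\<close> times \<open>\<theta>\<^sup>2\<close>.
\<close>

lemma signed_abs_normal_mgf:
  assumes Y: "distributed M lborel Y std_normal_density"
    and indep: "indep_var borel S borel Y"
    and S: "\<And>\<omega>. S \<omega> = 1 \<or> S \<omega> = - 1"
    and mean: "expectation S = \<Delta>" "0 \<le> \<Delta>"
    and \<theta>: "0 \<le> \<theta>" "\<theta> \<le> 1"
  shows "(\<integral>\<^sup>+\<omega>. ennreal (exp (- \<theta> * (S \<omega> * \<bar>Y \<omega>\<bar>))) \<partial>M)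
    \<le> ennreal (exp (- \<theta> * \<Delta> / 2 + 18 * \<theta>\<^sup>2))"
proof -
  have [measurable]: "Y \<in> borel_measurable M" "S \<in> borel_measurable M"
    using distributed_measurable[OF Y] indep_var_rv1[OF indep] by auto
  have SY: "indep_var borel S borel (\<lambda>\<omega>. \<bar>Y \<omega>\<bar>)"
    using indep_var_compose[OF indep, of "\<lambda>x. x" borel abs borel] by (simp add: comp_def)
  have abs_S: "\<bar>S \<omega>\<bar> = 1" for \<omega> using S[of \<omega>] by auto
  have int_S: "integrable M S"
    by (rule integrable_const_bound[of _ 1]) (auto simp: abs_S)
  note int_Y = std_normal_abs(1)[OF Y] and int_e = std_normal_exp_abs(1)[OF Y, of 2]
  have int_SY: "integrable M (\<lambda>\<omega>. S \<omega> * \<bar>Y \<omega>\<bar>)"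
    by (rule indep_var_integrable[OF SY int_S int_Y])
  have E_SY: "expectation (\<lambda>\<omega>. S \<omega> * \<bar>Y \<omega>\<bar>) = \<Delta> * expectation (\<lambda>\<omega>. \<bar>Y \<omega>\<bar>)"
    using indep_var_lebesgue_integral[OF SY int_S int_Y] mean by simp
  have pw: "exp (- \<theta> * (S \<omega> * \<bar>Y \<omega>\<bar>)) \<le> 1 - \<theta> * (S \<omega> * \<bar>Y \<omega>\<bar>) + \<theta>\<^sup>2 * exp (2 * \<bar>Y \<omega>\<bar>)" for \<omega>
  proof -
    define x where "x = - \<theta> * (S \<omega> * \<bar>Y \<omega>\<bar>)"
    have ax: "\<bar>x\<bar> = \<theta> * \<bar>Y \<omega>\<bar>" using \<theta> abs_S[of \<omega>] by (simp add: x_def abs_mult)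
    have "x\<^sup>2 / 2 * exp \<bar>x\<bar> = \<theta>\<^sup>2 * (\<bar>Y \<omega>\<bar>\<^sup>2 / 2 * exp \<bar>x\<bar>)"
      using arg_cong[OF ax, of "\<lambda>z. z\<^sup>2"] by (simp add: power_mult_distrib)
    also have "\<dots> \<le> \<theta>\<^sup>2 * (exp \<bar>Y \<omega>\<bar> * exp \<bar>Y \<omega>\<bar>)"
    proof (intro mult_left_mono mult_mono square_le_exp)
      show "exp \<bar>x\<bar> \<le> exp \<bar>Y \<omega>\<bar>" unfolding ax using \<theta> by (simp add: mult_left_le_one_le)
    qed auto
    also have "\<dots> = \<theta>\<^sup>2 * exp (2 * \<bar>Y \<omega>\<bar>)" by (simp flip: exp_add)
    finally show ?thesis using exp_le_quadratic[of x] by (simp add: x_def)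
  qed
  have int_rhs: "integrable M (\<lambda>\<omega>. 1 - \<theta> * (S \<omega> * \<bar>Y \<omega>\<bar>) + \<theta>\<^sup>2 * exp (2 * \<bar>Y \<omega>\<bar>))"
    using int_SY int_e by auto
  have "(\<integral>\<^sup>+\<omega>. ennreal (exp (- \<theta> * (S \<omega> * \<bar>Y \<omega>\<bar>))) \<partial>M)
    \<le> (\<integral>\<^sup>+\<omega>. ennreal (1 - \<theta> * (S \<omega> * \<bar>Y \<omega>\<bar>) + \<theta>\<^sup>2 * exp (2 * \<bar>Y \<omega>\<bar>)) \<partial>M)"
    by (intro nn_integral_mono ennreal_leI pw)
  also have "\<dots> = ennreal (expectation (\<lambda>\<omega>. 1 - \<theta> * (S \<omega> * \<bar>Y \<omega>\<bar>) + \<theta>\<^sup>2 * exp (2 * \<bar>Y \<omega>\<bar>)))"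
    by (intro nn_integral_eq_integral int_rhs AE_I2 order_trans[OF _ pw]) auto
  also have "expectation (\<lambda>\<omega>. 1 - \<theta> * (S \<omega> * \<bar>Y \<omega>\<bar>) + \<theta>\<^sup>2 * exp (2 * \<bar>Y \<omega>\<bar>))
      = 1 - \<theta> * (\<Delta> * expectation (\<lambda>\<omega>. \<bar>Y \<omega>\<bar>)) + \<theta>\<^sup>2 * expectation (\<lambda>\<omega>. exp (2 * \<bar>Y \<omega>\<bar>))"
    using int_SY int_e E_SY by (simp add: prob_space)
  also have "\<dots> \<le> 1 + (- \<theta> * \<Delta> / 2 + 18 * \<theta>\<^sup>2)"
  proof -
    have "\<theta> * \<Delta> * (1 / 2) \<le> \<theta> * \<Delta> * expectation (\<lambda>\<omega>. \<bar>Y \<omega>\<bar>)"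
      using \<theta> mean std_normal_abs(2)[OF Y] by (intro mult_left_mono) auto
    moreover have "expectation (\<lambda>\<omega>. exp (2 * \<bar>Y \<omega>\<bar>)) \<le> 18"
    proof -
      have "exp 2 = exp 1 * exp (1::real)" by (simp flip: exp_add)
      also have "\<dots> \<le> 3 * 3" using exp_le by (intro mult_mono) auto
      finally show ?thesis using std_normal_exp_abs(2)[OF Y, of 2] by simp
    qed
    then have "\<theta>\<^sup>2 * expectation (\<lambda>\<omega>. exp (2 * \<bar>Y \<omega>\<bar>)) \<le> \<theta>\<^sup>2 * 18"
      by (intro mult_left_mono) auto
    ultimately show ?thesis by simp
  qed
  also have "\<dots> \<le> exp (- \<theta> * \<Delta> / 2 + 18 * \<theta>\<^sup>2)" by (rule exp_ge_add_one_self)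
  finally show ?thesis by (simp add: ennreal_leI)
qed

lemma chernoff_lower_tail:
  assumes J: "finite J" "indep_vars (\<lambda>_. borel) Z J"
    and mgf: "\<And>j. j \<in> J \<Longrightarrow> (\<integral>\<^sup>+\<omega>. ennreal (exp (- \<theta> * Z j \<omega>)) \<partial>M) \<le> ennreal (exp \<kappa>)"
    and \<theta>: "0 \<le> \<theta>"
  shows "prob {\<omega> \<in> space M. (\<Sum>j\<in>J. Z j \<omega>) \<le> a} \<le> exp (\<theta> * a + real (card J) * \<kappa>)"
proof -
  have [measurable]: "Z j \<in> borel_measurable M" if "j \<in> J" for j
    using J(2) that unfolding indep_vars_def2 by auto
  let ?E = "{\<omega> \<in> space M. (\<Sum>j\<in>J. Z j \<omega>) \<le> a}"
  have [measurable]: "?E \<in> events" by measurable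
  have indep: "indep_vars (\<lambda>_. borel) (\<lambda>j \<omega>. ennreal (exp (- \<theta> * Z j \<omega>))) J"
    using indep_vars_compose2[OF J(2), of "\<lambda>_ z. ennreal (exp (- \<theta> * z))"] by simp
  have "ennreal (prob ?E) = (\<integral>\<^sup>+\<omega>. indicator ?E \<omega> \<partial>M)"
    by (simp add: emeasure_eq_measure)
  also have "\<dots> \<le> (\<integral>\<^sup>+\<omega>. ennreal (exp (\<theta> * a)) * (\<Prod>j\<in>J. ennreal (exp (- \<theta> * Z j \<omega>))) \<partial>M)"
  proof (intro nn_integral_mono)
    fix \<omega> assume "\<omega> \<in> space M"
    have "(\<Prod>j\<in>J. exp (- \<theta> * Z j \<omega>)) = exp (- \<theta> * (\<Sum>j\<in>J. Z j \<omega>))"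
      by (simp only: exp_sum[OF J(1), symmetric] sum_distrib_left)
    then have "exp (\<theta> * a) * (\<Prod>j\<in>J. exp (- \<theta> * Z j \<omega>)) = exp (\<theta> * (a - (\<Sum>j\<in>J. Z j \<omega>)))"
      by (simp add: algebra_simps flip: exp_add)
    moreover have "\<omega> \<in> ?E \<Longrightarrow> 1 \<le> exp (\<theta> * (a - (\<Sum>j\<in>J. Z j \<omega>)))"
      using \<theta> by simp
    ultimately have "\<omega> \<in> ?E \<Longrightarrow> ennreal 1 \<le> ennreal (exp (\<theta> * a) * (\<Prod>j\<in>J. exp (- \<theta> * Z j \<omega>)))"
      by (intro ennreal_leI) simp
    then show "indicator ?E \<omega> \<le> ennreal (exp (\<theta> * a)) * (\<Prod>j\<in>J. ennreal (exp (- \<theta> * Z j \<omega>)))"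
      by (auto simp: prod_ennreal ennreal_mult prod_nonneg split: split_indicator)
  qed
  also have "\<dots> = ennreal (exp (\<theta> * a)) * (\<Prod>j\<in>J. \<integral>\<^sup>+\<omega>. ennreal (exp (- \<theta> * Z j \<omega>)) \<partial>M)"
    by (subst indep_vars_nn_integral[OF J(1) indep, symmetric]) (auto intro!: nn_integral_cmult)
  also have "\<dots> \<le> ennreal (exp (\<theta> * a)) * (\<Prod>j\<in>J. ennreal (exp \<kappa>))"
    by (intro mult_left_mono prod_mono_ennreal mgf) auto
  also have "\<dots> = ennreal (exp (\<theta> * a + real (card J) * \<kappa>))"
    by (simp add: exp_add exp_of_nat_mult ennreal_mult ennreal_power)
  finally show ?thesis by simp
qed

end

section \<open>Windows of a Gaussian field with attack indicators\<close>

text \<open>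
  Sites of the field \<open>x\<close> are pairs of a time and a column: column \<open>None\<close> holds the attack indicators
  as numbers, column \<open>Some i\<close> the \<open>i\<close>-th input entries. A window of length \<open>K\<close> starting at \<open>a\<close> contains
  \<open>K\<close> inputs, but only its first \<open>K - 1\<close> indicators: in \<open>U\<^sub>t\<close> the newest input has
  time \<open>t\<close>, the newest attack in \<open>v\<^sub>t\<close> has time \<open>t - 1\<close>.
\<close>

definition quiet_sign :: "nat \<Rightarrow> nat \<Rightarrow> (nat \<times> nat option \<Rightarrow> real) \<Rightarrow> real" where
  "quiet_sign K a x = (if \<forall>\<tau>\<in>{a..<a + (K - 1)}. x (\<tau>, None) = 0 then 1 else - 1)"

text \<open>
  The scalar product of \<open>s\<close> with the inputs of the window, stacked from the newest to the oldest.
\<close>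

definition window_form ::
  "nat \<Rightarrow> nat \<Rightarrow> (nat \<Rightarrow> real) \<Rightarrow> nat \<Rightarrow> (nat \<times> nat option \<Rightarrow> real) \<Rightarrow> real" where
  "window_form m K s a x = (\<Sum>l<K * m. s l * x (a + (K - 1) - l div m, Some (l mod m)))"

definition site_columns :: "nat \<Rightarrow> nat option set" where
  "site_columns m = insert None (Some ` {..<m})"

lemma None_in_site_columns [simp]: "None \<in> site_columns m"
  and Some_in_site_columns [simp]: "Some i \<in> site_columns m \<longleftrightarrow> i < m"
  by (auto simp: site_columns_def)

lemma window_index:
  fixes l m K a :: nat
  assumes "l < K * m"
  shows "l div m < K" and "l mod m < m"
    and "a \<le> a + (K - 1) - l div m" and "a + (K - 1) - l div m < a + K"
proof -
  show d: "l div m < K" using assms by (rule less_mult_imp_div_less)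
  show "l mod m < m" using assms by (cases "m = 0") auto
  show "a \<le> a + (K - 1) - l div m" "a + (K - 1) - l div m < a + K" using d by auto
qed

lemma inj_on_window_index:
  fixes m K a :: nat
  shows
  "inj_on (\<lambda>l. (a + (K - 1) - l div m, Some (l mod m))) {..<K * m}"
proof (rule inj_onI)
  fix l l' assume l: "l \<in> {..<K * m}" "l' \<in> {..<K * m}"
    and eq: "(a + (K - 1) - l div m, Some (l mod m)) = (a + (K - 1) - l' div m, Some (l' mod m))"
  have "l div m < K" "l' div m < K" using window_index(1) l by auto
  moreover have "a + (K - 1) - l div m = a + (K - 1) - l' div m" using eq by simp
  ultimately have "l div m = l' div m" by linarith
  moreover have "l mod m = l' mod m" using eq by simp
  ultimately show "l = l'" by (metis div_mult_mod_eq)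
qed

lemma quiet_sign_cong:
  assumes "\<And>\<tau>. a \<le> \<tau> \<Longrightarrow> \<tau> < a + (K - 1) \<Longrightarrow> x (\<tau>, None) = y (\<tau>, None)"
  shows "quiet_sign K a x = quiet_sign K a y"
  using assms by (auto simp: quiet_sign_def)

lemma window_form_cong:
  assumes "\<And>\<tau> i. a \<le> \<tau> \<Longrightarrow> \<tau> < a + K \<Longrightarrow> i < m \<Longrightarrow> x (\<tau>, Some i) = y (\<tau>, Some i)"
  shows "window_form m K s a x = window_form m K s a y"
  unfolding window_form_def
  using assms window_index by (intro sum.cong) auto

lemma measurable_quiet_sign:
  assumes "\<And>\<tau>. a \<le> \<tau> \<Longrightarrow> \<tau> < a + (K - 1) \<Longrightarrow> (\<lambda>\<omega>. X \<omega> (\<tau>, None)) \<in> borel_measurable N"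
  shows "(\<lambda>\<omega>. quiet_sign K a (X \<omega>)) \<in> borel_measurable N"
proof -
  have [measurable]: "(\<lambda>\<omega>. X \<omega> (\<tau>, None)) \<in> borel_measurable N" if "\<tau> \<in> {a..<a + (K - 1)}" for \<tau>
    using assms that by auto
  show ?thesis unfolding quiet_sign_def by measurable
qed

lemma measurable_window_form:
  assumes "\<And>\<tau> i. a \<le> \<tau> \<Longrightarrow> \<tau> < a + K \<Longrightarrow> i < m \<Longrightarrow> (\<lambda>\<omega>. X \<omega> (\<tau>, Some i)) \<in> borel_measurable N"
  shows "(\<lambda>\<omega>. window_form m K s a (X \<omega>)) \<in> borel_measurable N"
  unfolding window_form_def
  using assms window_index by (intro borel_measurable_sum borel_measurable_times) auto

text \<open>
  All that the probabilistic argument uses of the attacked system: one family of independent variables,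
  indexed by time and column, so that disjoint sets of sites are independent.
\<close>

locale gaussian_attack_field = prob_space M
  for M :: "'a measure" +
  fixes m :: nat and p \<gamma> :: real and X :: "nat \<times> nat option \<Rightarrow> 'a \<Rightarrow> real"
  assumes indep: "indep_vars (\<lambda>_. borel) X (UNIV \<times> site_columns m)"
    and no_attack_prob: "\<And>t. prob {\<omega> \<in> space M. X (t, None) \<omega> = 0} = 1 - p"
    and normal: "\<And>t i. i < m \<Longrightarrow> distributed M lborel (X (t, Some i)) (normal_density 0 \<gamma>)"
    and \<gamma>_pos: "0 < \<gamma>"
begin

lemma measurable_site [measurable]:
  "c \<in> site_columns m \<Longrightarrow> X (t, c) \<in> borel_measurable M"
  using indep unfolding indep_vars_def2 by auto

lemma measurable_quiet_sign_field [measurable]: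
  "(\<lambda>\<omega>. quiet_sign K a (\<lambda>i. X i \<omega>)) \<in> borel_measurable M"
  by (rule measurable_quiet_sign) simp

lemma measurable_window_form_field [measurable]:
  "(\<lambda>\<omega>. window_form m K s a (\<lambda>i. X i \<omega>)) \<in> borel_measurable M"
  by (rule measurable_window_form) simp

text \<open>
  A window is quiet when \<open>K - 1\<close> independent indicators all vanish.
\<close>

lemma quiet_sign_mean:
  "expectation (\<lambda>\<omega>. quiet_sign K a (\<lambda>i. X i \<omega>)) = 2 * (1 - p) ^ (K - 1) - 1"
proof -
  let ?Q = "{\<omega> \<in> space M. \<forall>\<tau>\<in>{a..<a + (K - 1)}. X (\<tau>, None) \<omega> = 0}"
  have Q: "?Q \<in> events" by measurable
  have "prob ?Q = (1 - p) ^ (K - 1)"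
  proof (cases "K - 1 = 0")
    case True
    then show ?thesis by (simp add: prob_space)
  next
    case False
    let ?J = "{a..<a + (K - 1)} \<times> {None :: nat option}"
    have "prob (\<Inter>j\<in>?J. X j -` {0} \<inter> space M) = (\<Prod>j\<in>?J. prob (X j -` {0} \<inter> space M))"
      by (rule indep_varsD[OF indep]) (use False in auto)
    also have "(\<Inter>j\<in>?J. X j -` {0} \<inter> space M) = ?Q" using False by auto
    also have "(\<Prod>j\<in>?J. prob (X j -` {0} \<inter> space M)) = (\<Prod>j\<in>?J. 1 - p)"
    proof (intro prod.cong refl)
      fix j assume "j \<in> ?J"
      then obtain t where "j = (t, None)" by auto
      moreover have "X (t, None) -` {0} \<inter> space M = {\<omega> \<in> space M. X (t, None) \<omega> = 0}" by auto
      ultimately show "prob (X j -` {0} \<inter> space M) = 1 - p" using no_attack_prob by simp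
    qed
    also have "\<dots> = (1 - p) ^ (K - 1)" by simp
    finally show ?thesis .
  qed
  moreover have "expectation (\<lambda>\<omega>. quiet_sign K a (\<lambda>i. X i \<omega>))
      = expectation (\<lambda>\<omega>. 2 * indicator ?Q \<omega> - 1 :: real)"
    by (intro Bochner_Integration.integral_cong) (auto simp: quiet_sign_def indicator_def)
  moreover have "expectation (\<lambda>\<omega>. 2 * indicator ?Q \<omega> - 1 :: real) = 2 * prob ?Q - 1"
  proof -
    have "integrable M (\<lambda>\<omega>. 2 * indicator ?Q \<omega> :: real)"
      using Q by (intro integrable_mult_right integrable_real_indicator) (auto simp: emeasure_eq_measure)
    then have "expectation (\<lambda>\<omega>. 2 * indicator ?Q \<omega> - 1 :: real)
        = expectation (\<lambda>\<omega>. 2 * indicator ?Q \<omega> :: real) - expectation (\<lambda>\<omega>. 1)"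
      by (intro Bochner_Integration.integral_diff) auto
    then show ?thesis using Q by (simp add: prob_space)
  qed
  ultimately show ?thesis by simp
qed

text \<open>
  A linear combination of distinct, hence independent, Gaussian entries is Gaussian. Entries with
  coefficient 0 are left out, as a normal distribution needs a positive standard deviation.
\<close>

lemma window_form_normal:
  assumes s: "0 < L2_set s {..<K * m}"
  shows "distributed M lborel
    (\<lambda>\<omega>. window_form m K s a (\<lambda>i. X i \<omega>) / (\<gamma> * L2_set s {..<K * m})) std_normal_density"
proof -
  define f where "f l = (a + (K - 1) - l div m, Some (l mod m))" for l
  \<comment> \<open>indices whose summand has positive variance\<close>
  define I where "I = {l \<in> {..<K * m}. s l \<noteq> 0}"
  have "I \<noteq> {}"
    using s unfolding I_def by (auto simp: L2_set_def intro: ccontr)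
  have I: "finite I" "l \<in> I \<Longrightarrow> l < K * m \<and> s l \<noteq> 0 \<and> l mod m < m" for l
    using window_index(2) by (auto simp: I_def)
  have inj: "inj_on f I"
    unfolding f_def[abs_def]
    by (rule inj_on_subset[OF inj_on_window_index[of a K m]]) (auto simp: I_def)
  have "indep_vars (\<lambda>l. PiM {f l} (\<lambda>_. borel)) (\<lambda>l \<omega>. restrict (\<lambda>i. X i \<omega>) {f l}) I"
    by (rule indep_vars_restrict[OF indep])
      (use I inj in \<open>auto simp: disjoint_family_on_def inj_on_def f_def\<close>)
  moreover have "(\<lambda>x. s l * x (f l)) \<in> borel_measurable (PiM {f l} (\<lambda>_. borel))" for l
    by (intro borel_measurable_times borel_measurable_const measurable_component_singleton) simp
  ultimately have "indep_vars (\<lambda>_. borel) (\<lambda>l \<omega>. s l * restrict (\<lambda>i. X i \<omega>) {f l} (f l)) I"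
    by (rule indep_vars_compose2)
  then have ind: "indep_vars (\<lambda>_. borel) (\<lambda>l \<omega>. s l * X (f l) \<omega>) I" by simp
  have "distributed M lborel (\<lambda>\<omega>. \<Sum>l\<in>I. s l * X (f l) \<omega>)
    (normal_density (\<Sum>l\<in>I. 0) (sqrt (\<Sum>l\<in>I. (\<bar>s l\<bar> * \<gamma>)\<^sup>2)))"
  proof (rule sum_indep_normal[OF I(1) \<open>I \<noteq> {}\<close> ind])
    fix l assume "l \<in> I"
    then show "distributed M lborel (\<lambda>\<omega>. s l * X (f l) \<omega>) (normal_density 0 (\<bar>s l\<bar> * \<gamma>))"
      using normal_density_affine[OF normal[of "l mod m" "a + (K - 1) - l div m"], of "s l" 0] I \<gamma>_pos
      by (simp add: f_def)
    show "0 < \<bar>s l\<bar> * \<gamma>" using I \<open>l \<in> I\<close> \<gamma>_pos by simp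
  qed
  moreover have "(\<Sum>l\<in>I. s l * X (f l) \<omega>) = window_form m K s a (\<lambda>i. X i \<omega>)" for \<omega>
    unfolding window_form_def I_def f_def by (rule sum.mono_neutral_left) auto
  moreover have "sqrt (\<Sum>l\<in>I. (\<bar>s l\<bar> * \<gamma>)\<^sup>2) = \<gamma> * L2_set s {..<K * m}"
  proof -
    have "(\<Sum>l\<in>I. (\<bar>s l\<bar> * \<gamma>)\<^sup>2) = (\<Sum>l<K * m. (\<bar>s l\<bar> * \<gamma>)\<^sup>2)"
      unfolding I_def by (rule sum.mono_neutral_left) auto
    also have "\<dots> = \<gamma>\<^sup>2 * (\<Sum>l<K * m. (s l)\<^sup>2)"
      by (simp add: power_mult_distrib sum_distrib_left mult.commute)
    finally show ?thesis using \<gamma>_pos by (simp add: L2_set_def real_sqrt_mult)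
  qed
  ultimately show ?thesis
    using normal_standard_normal_convert[of "\<gamma> * L2_set s {..<K * m}"
        "\<lambda>\<omega>. window_form m K s a (\<lambda>i. X i \<omega>)" 0] s \<gamma>_pos by simp
qed

text \<open>
  The sign reads the column of indicators, the linear form the columns of inputs.
\<close>

lemma sign_form_indep:
  "indep_var borel (\<lambda>\<omega>. quiet_sign K a (\<lambda>i. X i \<omega>))
     borel (\<lambda>\<omega>. window_form m K s a (\<lambda>i. X i \<omega>) / c)"
proof -
  let ?A = "UNIV \<times> {None :: nat option}" and ?B = "UNIV \<times> Some ` {..<m}"
  have "indep_var (PiM ?A (\<lambda>_. borel)) (\<lambda>\<omega>. restrict (\<lambda>i. X i \<omega>) ?A)
    (PiM ?B (\<lambda>_. borel)) (\<lambda>\<omega>. restrict (\<lambda>i. X i \<omega>) ?B)"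
    by (rule indep_var_restrict[OF indep]) (auto simp: site_columns_def)
  moreover have "(\<lambda>x. quiet_sign K a x) \<in> borel_measurable (PiM ?A (\<lambda>_. borel))"
    by (rule measurable_quiet_sign) (rule measurable_component_singleton, auto)
  moreover have "(\<lambda>x. window_form m K s a x / c) \<in> borel_measurable (PiM ?B (\<lambda>_. borel))"
    by (intro borel_measurable_divide measurable_window_form borel_measurable_const)
      (rule measurable_component_singleton, auto)
  ultimately have "indep_var borel ((\<lambda>x. quiet_sign K a x) \<circ> (\<lambda>\<omega>. restrict (\<lambda>i. X i \<omega>) ?A))
    borel ((\<lambda>x. window_form m K s a x / c) \<circ> (\<lambda>\<omega>. restrict (\<lambda>i. X i \<omega>) ?B))"
    by (rule indep_var_compose)
  moreover have "quiet_sign K a (restrict (\<lambda>i. X i \<omega>) ?A) = quiet_sign K a (\<lambda>i. X i \<omega>)" for \<omega>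
    by (rule quiet_sign_cong) auto
  moreover have "window_form m K s a (restrict (\<lambda>i. X i \<omega>) ?B)
      = window_form m K s a (\<lambda>i. X i \<omega>)" for \<omega>
    by (rule window_form_cong) auto
  ultimately show ?thesis by (simp add: comp_def)
qed

lemma disjoint_windows_indep:
  assumes "disjoint_family_on (\<lambda>a. {a..<a + K}) J"
  shows "indep_vars (\<lambda>_. borel) (\<lambda>a \<omega>. quiet_sign K a (\<lambda>i. X i \<omega>)
    * \<bar>window_form m K s a (\<lambda>i. X i \<omega>) / c\<bar>) J"
proof -
  let ?B = "\<lambda>a. {a..<a + K} \<times> site_columns m"
  let ?f = "\<lambda>a x. quiet_sign K a x * \<bar>window_form m K s a x / c\<bar>"
  have "indep_vars (\<lambda>a. PiM (?B a) (\<lambda>_. borel)) (\<lambda>a \<omega>. restrict (\<lambda>i. X i \<omega>) (?B a)) J"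
  proof (rule indep_vars_restrict[OF indep])
    show "disjoint_family_on ?B J"
      using assms unfolding disjoint_family_on_def by blast
  qed auto
  moreover have "?f a \<in> borel_measurable (PiM (?B a) (\<lambda>_. borel))" for a
    by (intro borel_measurable_times borel_measurable_abs borel_measurable_divide
        measurable_quiet_sign measurable_window_form borel_measurable_const)
      (rule measurable_component_singleton, auto)+
  ultimately have "indep_vars (\<lambda>_. borel) (\<lambda>a \<omega>. ?f a (restrict (\<lambda>i. X i \<omega>) (?B a))) J"
    by (rule indep_vars_compose2)
  moreover have "?f a (restrict (\<lambda>i. X i \<omega>) (?B a)) = ?f a (\<lambda>i. X i \<omega>)" for a \<omega>
  proof -
    have "quiet_sign K a (restrict (\<lambda>i. X i \<omega>) (?B a)) = quiet_sign K a (\<lambda>i. X i \<omega>)"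
      by (rule quiet_sign_cong) auto
    moreover have "window_form m K s a (restrict (\<lambda>i. X i \<omega>) (?B a))
        = window_form m K s a (\<lambda>i. X i \<omega>)"
      by (rule window_form_cong) auto
    ultimately show ?thesis by simp
  qed
  ultimately show ?thesis by (simp only:)
qed

text \<open>
  The threshold is half the guaranteed mean. With the moment bound
  \<open>exp (- \<theta> * \<Delta> / 2 + 18 * \<theta>\<^sup>2)\<close> the exponent per window is \<open>- \<theta> * \<Delta> / 4 + 18 * \<theta>\<^sup>2\<close>, which
  is smallest at \<open>\<theta> = \<Delta> / 144\<close>.
\<close>

lemma disjoint_windows_lower_tail:
  assumes J: "finite J" "disjoint_family_on (\<lambda>a. {a..<a + K}) J"
    and s: "0 < L2_set s {..<K * m}"
    and \<Delta>: "\<Delta> = 2 * (1 - p) ^ (K - 1) - 1" "0 \<le> \<Delta>" "\<Delta> \<le> 1"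
  shows "prob {\<omega> \<in> space M.
      (\<Sum>a\<in>J. quiet_sign K a (\<lambda>i. X i \<omega>) * \<bar>window_form m K s a (\<lambda>i. X i \<omega>)\<bar>)
        \<le> real (card J) * (\<gamma> * L2_set s {..<K * m} * \<Delta> / 4)}
    \<le> exp (- real (card J) * \<Delta>\<^sup>2 / 1152)"
proof -
  define c where "c = \<gamma> * L2_set s {..<K * m}"
  have c: "0 < c" using s \<gamma>_pos by (simp add: c_def)
  let ?Z = "\<lambda>a \<omega>. quiet_sign K a (\<lambda>i. X i \<omega>) * \<bar>window_form m K s a (\<lambda>i. X i \<omega>) / c\<bar>"
  let ?\<theta> = "\<Delta> / 144"
  have mgf: "(\<integral>\<^sup>+\<omega>. ennreal (exp (- ?\<theta> * ?Z a \<omega>)) \<partial>M)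
      \<le> ennreal (exp (- ?\<theta> * \<Delta> / 2 + 18 * ?\<theta>\<^sup>2))" for a
    by (rule signed_abs_normal_mgf[OF window_form_normal[OF s, of a, folded c_def] sign_form_indep])
      (use \<Delta> quiet_sign_mean in \<open>auto simp: quiet_sign_def\<close>)
  have "prob {\<omega> \<in> space M. (\<Sum>a\<in>J. ?Z a \<omega>) \<le> real (card J) * (\<Delta> / 4)}
      \<le> exp (?\<theta> * (real (card J) * (\<Delta> / 4)) + real (card J) * (- ?\<theta> * \<Delta> / 2 + 18 * ?\<theta>\<^sup>2))"
    by (rule chernoff_lower_tail[OF J(1) disjoint_windows_indep[OF J(2)] mgf]) (use \<Delta> in auto)
  also have "?\<theta> * (real (card J) * (\<Delta> / 4)) + real (card J) * (- ?\<theta> * \<Delta> / 2 + 18 * ?\<theta>\<^sup>2)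
      = - real (card J) * \<Delta>\<^sup>2 / 1152"
    by (simp add: power2_eq_square field_simps)
  also have "{\<omega> \<in> space M. (\<Sum>a\<in>J. ?Z a \<omega>) \<le> real (card J) * (\<Delta> / 4)} = {\<omega> \<in> space M.
      (\<Sum>a\<in>J. quiet_sign K a (\<lambda>i. X i \<omega>) * \<bar>window_form m K s a (\<lambda>i. X i \<omega>)\<bar>)
        \<le> real (card J) * (c * \<Delta> / 4)}"
    using c by (simp add: abs_divide sum_divide_distrib[symmetric] pos_divide_le_eq mult_ac)
  finally show ?thesis by (simp only: c_def)
qed

end

section \<open>Deviation of the signed sum in a fixed direction\<close>

lemma residue_class_windows_disjoint:
  "disjoint_family_on (\<lambda>a. {a..<a + K}) {a \<in> {..<T}. a mod K = c}" for K T c :: nat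
  unfolding disjoint_family_on_def
proof (intro ballI impI)
  have gap: "a + K \<le> b" if "a < b" "a mod K = b mod K" for a b :: nat
  proof -
    have "K dvd b - a" using that by (metis mod_eq_dvd_iff_nat less_imp_le)
    then show ?thesis using that dvd_imp_le[of K "b - a"] by linarith
  qed
  fix a b assume *: "a \<in> {a \<in> {..<T}. a mod K = c}" "b \<in> {a \<in> {..<T}. a mod K = c}" "a \<noteq> b"
  then consider "a < b" | "b < a" by linarith
  then show "{a..<a + K} \<inter> {b..<b + K} = {}"
    by cases (use gap[of a b] gap[of b a] * in auto)
qed

text \<open>
  Rounding \<open>T / K\<close> down costs at most a factor 2, as \<open>K \<le> T\<close>.
\<close>

lemma card_residue_class_ge:
  fixes K T c :: nat
  assumes "c < K" "K \<le> T"
  shows "real T / (2 * real K) \<le> real (card {a \<in> {..<T}. a mod K = c})"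
proof -
  have "(\<lambda>j. c + K * j) ` {..<T div K} \<subseteq> {a \<in> {..<T}. a mod K = c}"
  proof (intro image_subsetI CollectI conjI)
    fix j assume "j \<in> {..<T div K}"
    then have "K * (j + 1) \<le> K * (T div K)" by (intro mult_left_mono) auto
    also have "\<dots> \<le> T" by simp
    finally show "c + K * j \<in> {..<T}" using assms by simp
    show "(c + K * j) mod K = c" using assms by simp
  qed
  then have "card ((\<lambda>j. c + K * j) ` {..<T div K}) \<le> card {a \<in> {..<T}. a mod K = c}"
    by (intro card_mono) auto
  moreover have "inj_on (\<lambda>j. c + K * j) {..<T div K}" using assms by (auto intro!: inj_onI)
  ultimately have "T div K \<le> card {a \<in> {..<T}. a mod K = c}" by (simp add: card_image)
  moreover have "T \<le> 2 * K * (T div K)"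
  proof -
    have "1 \<le> T div K" using assms by (simp add: div_greater_zero_iff Suc_le_eq)
    then have "K * 1 \<le> K * (T div K)" by (rule mult_left_mono) simp
    moreover have "T < K * (T div K) + K"
      using assms mult_div_mod_eq[of K T] mod_less_divisor[of K T] by linarith
    ultimately show ?thesis by linarith
  qed
  ultimately have "T \<le> 2 * K * card {a \<in> {..<T}. a mod K = c}"
    by (meson mult_left_mono order_trans zero_le)
  then have "real T \<le> real (2 * K * card {a \<in> {..<T}. a mod K = c})" by (rule of_nat_mono)
  then show ?thesis using assms by (simp add: divide_le_eq mult_ac)
qed

lemma sum_residue_classes:
  fixes f :: "nat \<Rightarrow> 'b :: comm_monoid_add" and K :: nat
  assumes "0 < K"
  shows "(\<Sum>a<T. f a) = (\<Sum>c<K. \<Sum>a | a \<in> {..<T} \<and> a mod K = c. f a)"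
  by (rule sum.group[symmetric]) (use assms in auto)

lemma sum_div_mod:
  fixes f :: "nat \<Rightarrow> real"
  shows "(\<Sum>l<K * m. f (l mod m)) = real K * (\<Sum>i<m. f i)"
proof -
  have "(\<Sum>l\<in>{j * m..<j * m + m}. f (l mod m)) = (\<Sum>i<m. f i)" for j
    using sum.shift_bounds_nat_ivl[of "\<lambda>l. f (l mod m)" 0 "j * m" m]
    by (simp add: atLeast0LessThan add.commute)
  then show ?thesis
    using sum.nat_group[of "\<lambda>l. f (l mod m)" m K] by simp
qed

context gaussian_attack_field
begin

abbreviation signed_sum :: "nat \<Rightarrow> nat \<Rightarrow> (nat \<Rightarrow> real) \<Rightarrow> 'a \<Rightarrow> real" where
  "signed_sum K T s \<omega> \<equiv>
     (\<Sum>a<T. quiet_sign K a (\<lambda>i. X i \<omega>) * \<bar>window_form m K s a (\<lambda>i. X i \<omega>)\<bar>)"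

abbreviation input_mass :: "nat \<Rightarrow> 'a \<Rightarrow> real" where
  "input_mass N \<omega> \<equiv> (\<Sum>\<tau><N. \<Sum>i<m. \<bar>X (\<tau>, Some i) \<omega>\<bar>)"

lemma measurable_input_mass [measurable]: "input_mass N \<in> borel_measurable M"
  by (intro borel_measurable_sum borel_measurable_abs measurable_site) auto

text \<open>
  Distinct windows starting at times congruent modulo \<open>K\<close> are disjoint. If the whole sum is small, then the sum
  over some residue class is small, and each class has at least \<open>T / (2 * K)\<close> members.
\<close>

lemma signed_sum_lower_tail:
  assumes K: "1 \<le> K" "K \<le> T"
    and s: "0 < L2_set s {..<K * m}"
    and \<Delta>: "\<Delta> = 2 * (1 - p) ^ (K - 1) - 1" "0 \<le> \<Delta>" "\<Delta> \<le> 1"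
  shows "prob {\<omega> \<in> space M. signed_sum K T s \<omega> \<le> real T * (\<gamma> * L2_set s {..<K * m} * \<Delta> / 4)}
    \<le> real K * exp (- (real T / (2 * real K)) * \<Delta>\<^sup>2 / 1152)"
proof -
  define \<mu> where "\<mu> = \<gamma> * L2_set s {..<K * m} * \<Delta> / 4"
  let ?J = "\<lambda>c. {a \<in> {..<T}. a mod K = c}"
  let ?G = "\<lambda>c \<omega>. \<Sum>a\<in>?J c. quiet_sign K a (\<lambda>i. X i \<omega>) * \<bar>window_form m K s a (\<lambda>i. X i \<omega>)\<bar>"
  let ?E = "\<lambda>c. {\<omega> \<in> space M. ?G c \<omega> \<le> real (card (?J c)) * \<mu>}"
  have [measurable]: "?E c \<in> events" for c by measurable
  have split: "signed_sum K T s \<omega> = (\<Sum>c<K. ?G c \<omega>)" for \<omega>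
    by (rule sum_residue_classes) (use K in simp)
  have T: "real T * \<mu> = (\<Sum>c<K. real (card (?J c)) * \<mu>)"
    using sum_residue_classes[of K "\<lambda>_. \<mu>" T] K by simp
  have "{\<omega> \<in> space M. signed_sum K T s \<omega> \<le> real T * \<mu>} \<subseteq> (\<Union>c<K. ?E c)"
  proof
    fix \<omega> assume \<omega>: "\<omega> \<in> {\<omega> \<in> space M. signed_sum K T s \<omega> \<le> real T * \<mu>}"
    show "\<omega> \<in> (\<Union>c<K. ?E c)"
    proof (rule ccontr)
      assume "\<omega> \<notin> (\<Union>c<K. ?E c)"
      then have "(\<Sum>c<K. real (card (?J c)) * \<mu>) < (\<Sum>c<K. ?G c \<omega>)"
        using \<omega> K by (intro sum_strict_mono) (auto simp: not_le lessThan_empty_iff)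
      then show False using \<omega> unfolding split T by simp
    qed
  qed
  then have "prob {\<omega> \<in> space M. signed_sum K T s \<omega> \<le> real T * \<mu>} \<le> prob (\<Union>c<K. ?E c)"
    by (intro finite_measure_mono) auto
  also have "\<dots> \<le> (\<Sum>c<K. prob (?E c))"
    by (rule finite_measure_subadditive_finite) auto
  also have "\<dots> \<le> (\<Sum>c<K. exp (- (real T / (2 * real K)) * \<Delta>\<^sup>2 / 1152))"
  proof (intro sum_mono)
    fix c assume "c \<in> {..<K}"
    have "prob (?E c) \<le> exp (- real (card (?J c)) * \<Delta>\<^sup>2 / 1152)"
      unfolding \<mu>_def
      by (rule disjoint_windows_lower_tail[OF _ residue_class_windows_disjoint s \<Delta>]) simp
    also have "\<dots> \<le> exp (- (real T / (2 * real K)) * \<Delta>\<^sup>2 / 1152)"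
    proof -
      have "real T / (2 * real K) * \<Delta>\<^sup>2 \<le> real (card (?J c)) * \<Delta>\<^sup>2"
        using card_residue_class_ge[of c K T] \<open>c \<in> {..<K}\<close> K by (intro mult_right_mono) auto
      then show ?thesis by simp
    qed
    finally show "prob (?E c) \<le> exp (- (real T / (2 * real K)) * \<Delta>\<^sup>2 / 1152)" .
  qed
  also have "\<dots> = real K * exp (- (real T / (2 * real K)) * \<Delta>\<^sup>2 / 1152)" by simp
  finally show ?thesis unfolding \<mu>_def .
qed

text \<open>
  Chernoff's bound with parameter 1: an absolute standard normal variable has
  exponential moment at most \<open>2 * exp (1 / 2) \<le> exp 2\<close>, so an average of 3
  over all entries costs a factor \<open>exp (2 - 3)\<close> per entry.
\<close>

lemma input_mass_upper_tail:
  "prob {\<omega> \<in> space M. 3 * (real N * real m) * \<gamma> \<le> input_mass N \<omega>} \<le> exp (- (real N * real m))"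
proof -
  let ?J = "{..<N} \<times> Some ` {..<m}"
  let ?Z = "\<lambda>j \<omega>. - \<bar>X j \<omega> / \<gamma>\<bar>"
  have "indep_vars (\<lambda>_. borel) X ?J"
    by (rule indep_vars_subset[OF indep]) (auto simp: site_columns_def)
  then have ind: "indep_vars (\<lambda>_. borel) ?Z ?J"
    using indep_vars_compose2[of "\<lambda>_. borel" X ?J "\<lambda>_ z. - \<bar>z / \<gamma>\<bar>"] by simp
  have mgf: "(\<integral>\<^sup>+\<omega>. ennreal (exp (- 1 * ?Z j \<omega>)) \<partial>M) \<le> ennreal (exp 2)" if "j \<in> ?J" for j
  proof -
    have Y: "distributed M lborel (\<lambda>\<omega>. X j \<omega> / \<gamma>) std_normal_density"
      using normal_standard_normal_convert[OF \<gamma>_pos, of "X j" 0] normal that by auto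
    have "(\<integral>\<^sup>+\<omega>. ennreal (exp (1 * \<bar>X j \<omega> / \<gamma>\<bar>)) \<partial>M)
        = ennreal (expectation (\<lambda>\<omega>. exp (1 * \<bar>X j \<omega> / \<gamma>\<bar>)))"
      by (intro nn_integral_eq_integral std_normal_exp_abs[OF Y]) auto
    also have "expectation (\<lambda>\<omega>. exp (1 * \<bar>X j \<omega> / \<gamma>\<bar>)) \<le> 2 * exp (1\<^sup>2 / 2)"
      by (rule std_normal_exp_abs[OF Y])
    also have "\<dots> \<le> exp 1 * exp (1\<^sup>2 / 2)"
      using exp_ge_add_one_self[of 1] by (intro mult_right_mono) auto
    also have "\<dots> \<le> exp (2::real)" by (simp flip: exp_add)
    finally show ?thesis by (simp add: ennreal_leI)
  qed
  have card: "card ?J = N * m" by (simp add: card_cartesian_product card_image)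
  have sum: "(\<Sum>j\<in>?J. ?Z j \<omega>) = - (input_mass N \<omega> / \<gamma>)" for \<omega>
    using \<gamma>_pos by (simp add: sum.cartesian_product' sum.reindex sum_negf
        sum_divide_distrib abs_divide)
  have "prob {\<omega> \<in> space M. (\<Sum>j\<in>?J. ?Z j \<omega>) \<le> - 3 * (real N * real m)}
      \<le> exp (1 * (- 3 * (real N * real m)) + real (card ?J) * 2)"
    by (rule chernoff_lower_tail[OF _ ind mgf]) auto
  also have "{\<omega> \<in> space M. (\<Sum>j\<in>?J. ?Z j \<omega>) \<le> - 3 * (real N * real m)}
      = {\<omega> \<in> space M. 3 * (real N * real m) * \<gamma> \<le> input_mass N \<omega>}"
    unfolding sum using \<gamma>_pos by (simp add: field_simps)
  finally show ?thesis by (simp add: card)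
qed

text \<open>
  Every input entry occurs in at most \<open>K\<close> windows.
\<close>

lemma sum_abs_windows_le_input_mass:
  "(\<Sum>a<T. \<Sum>l<K * m. \<bar>X (a + (K - 1) - l div m, Some (l mod m)) \<omega>\<bar>)
     \<le> real K * input_mass (T + (K - 1)) \<omega>"
proof -
  let ?h = "\<lambda>i. \<Sum>\<tau><T + (K - 1). \<bar>X (\<tau>, Some i) \<omega>\<bar>"
  have "(\<Sum>a<T. \<bar>X (a + (K - 1) - l div m, Some (l mod m)) \<omega>\<bar>) \<le> ?h (l mod m)"
    if "l < K * m" for l
  proof -
    let ?g = "\<lambda>a. a + (K - 1) - l div m"
    have d: "l div m \<le> K - 1" using window_index(1)[OF that] by linarith
    then have inj: "inj_on ?g {..<T}" by (intro inj_onI) auto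
    have "(\<Sum>a<T. \<bar>X (?g a, Some (l mod m)) \<omega>\<bar>) = (\<Sum>\<tau>\<in>?g ` {..<T}. \<bar>X (\<tau>, Some (l mod m)) \<omega>\<bar>)"
      using inj by (simp add: sum.reindex)
    also have "\<dots> \<le> ?h (l mod m)" by (intro sum_mono2) auto
    finally show ?thesis .
  qed
  then have "(\<Sum>l<K * m. \<Sum>a<T. \<bar>X (a + (K - 1) - l div m, Some (l mod m)) \<omega>\<bar>)
      \<le> (\<Sum>l<K * m. ?h (l mod m))" by (intro sum_mono) auto
  also have "\<dots> = real K * (\<Sum>i<m. ?h i)" by (rule sum_div_mod)
  also have "(\<Sum>i<m. ?h i) = input_mass (T + (K - 1)) \<omega>" by (rule sum.swap)
  finally show ?thesis by (simp add: sum.swap[of _ "{..<K * m}"])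
qed

text \<open>
  A quiet sign has absolute value 1, so each summand is Lipschitz in the direction with respect to the maximum norm.
\<close>

lemma signed_sum_perturb:
  assumes "\<And>l. l < K * m \<Longrightarrow> \<bar>s l - g l\<bar> \<le> \<epsilon>"
  shows "signed_sum K T g \<omega> - \<epsilon> * (real K * input_mass (T + (K - 1)) \<omega>) \<le> signed_sum K T s \<omega>"
proof -
  let ?x = "\<lambda>a l. X (a + (K - 1) - l div m, Some (l mod m)) \<omega>"
  have win: "quiet_sign K a (\<lambda>i. X i \<omega>) * \<bar>window_form m K g a (\<lambda>i. X i \<omega>)\<bar>
      - \<epsilon> * (\<Sum>l<K * m. \<bar>?x a l\<bar>)
    \<le> quiet_sign K a (\<lambda>i. X i \<omega>) * \<bar>window_form m K s a (\<lambda>i. X i \<omega>)\<bar>" for a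
  proof -
    have "\<bar>window_form m K s a (\<lambda>i. X i \<omega>) - window_form m K g a (\<lambda>i. X i \<omega>)\<bar>
        = \<bar>\<Sum>l<K * m. (s l - g l) * ?x a l\<bar>"
      by (simp add: window_form_def sum_subtractf left_diff_distrib)
    also have "\<dots> \<le> (\<Sum>l<K * m. \<bar>(s l - g l) * ?x a l\<bar>)" by (rule sum_abs)
    also have "\<dots> \<le> (\<Sum>l<K * m. \<epsilon> * \<bar>?x a l\<bar>)"
      using assms by (intro sum_mono) (auto simp: abs_mult intro!: mult_right_mono)
    also have "\<dots> = \<epsilon> * (\<Sum>l<K * m. \<bar>?x a l\<bar>)" by (simp add: sum_distrib_left)
    finally show ?thesis by (auto simp: quiet_sign_def)
  qed
  have \<epsilon>: "0 \<le> \<epsilon> \<or> K * m = 0"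
    using assms[of 0] by (metis abs_ge_zero gr0I order_trans)
  have "\<epsilon> * (\<Sum>a<T. \<Sum>l<K * m. \<bar>?x a l\<bar>) \<le> \<epsilon> * (real K * input_mass (T + (K - 1)) \<omega>)"
    using \<epsilon>
  proof
    assume "0 \<le> \<epsilon>"
    then show ?thesis using sum_abs_windows_le_input_mass by (rule mult_left_mono[rotated])
  next
    assume "K * m = 0"
    then show ?thesis by auto
  qed
  moreover have "signed_sum K T g \<omega> - \<epsilon> * (\<Sum>a<T. \<Sum>l<K * m. \<bar>?x a l\<bar>) \<le> signed_sum K T s \<omega>"
    unfolding sum_distrib_left sum_subtractf[symmetric] using win
    by (intro sum_mono) (simp add: sum_distrib_left)
  ultimately show ?thesis by linarith
qed

end

section \<open>Uniformity over the unit sphere\<close>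

text \<open>
  The coordinates range over the multiples of \<open>\<epsilon>\<close> in, roughly, \<open>[-1, 1]\<close>.
\<close>

definition grid :: "nat \<Rightarrow> real \<Rightarrow> (nat \<Rightarrow> real) set" where
  "grid d \<epsilon> = (\<Pi>\<^sub>E l\<in>{..<d}. (\<lambda>j. \<epsilon> * of_int j) ` {- \<lceil>1 / \<epsilon>\<rceil>..\<lceil>1 / \<epsilon>\<rceil>})"

lemma finite_grid: "finite (grid d \<epsilon>)"
  unfolding grid_def by (intro finite_PiE) auto

lemma card_grid_le:
  assumes "0 < \<epsilon>" "\<epsilon> \<le> 1 / 3"
  shows "real (card (grid d \<epsilon>)) \<le> (3 / \<epsilon>) ^ d"
proof -
  have ge: "3 \<le> 1 / \<epsilon>" using assms by (simp add: field_simps)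
  have "card ((\<lambda>j. \<epsilon> * of_int j) ` {- \<lceil>1 / \<epsilon>\<rceil>..\<lceil>1 / \<epsilon>\<rceil>}) \<le> card {- \<lceil>1 / \<epsilon>\<rceil>..\<lceil>1 / \<epsilon>\<rceil>}"
    by (rule card_image_le) simp
  then have "real (card ((\<lambda>j. \<epsilon> * of_int j) ` {- \<lceil>1 / \<epsilon>\<rceil>..\<lceil>1 / \<epsilon>\<rceil>}))
      \<le> real (nat (2 * \<lceil>1 / \<epsilon>\<rceil> + 1))" by simp
  also have "\<dots> = 2 * of_int \<lceil>1 / \<epsilon>\<rceil> + 1"
    using ge by simp
  also have "\<dots> \<le> 3 / \<epsilon>" using ge of_int_ceiling_le_add_one[of "1 / \<epsilon>"] by simp linarith
  finally have "real (card ((\<lambda>j. \<epsilon> * of_int j) ` {- \<lceil>1 / \<epsilon>\<rceil>..\<lceil>1 / \<epsilon>\<rceil>})) ^ d \<le> (3 / \<epsilon>) ^ d"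
    by (rule power_mono) simp
  then show ?thesis unfolding grid_def by (simp add: card_PiE)
qed

text \<open>
  Rounding every coordinate down to a multiple of \<open>\<epsilon>\<close> moves \<open>s\<close> by at most \<open>d * \<epsilon>\<close> in norm.
\<close>

lemma grid_approx:
  assumes \<epsilon>: "0 < \<epsilon>" "real d * \<epsilon> \<le> 1 / 2"
    and s: "L2_set s {..<d} = 1"
  obtains g where "g \<in> grid d \<epsilon>" "\<And>l. l < d \<Longrightarrow> \<bar>s l - g l\<bar> \<le> \<epsilon>" "1 / 2 \<le> L2_set g {..<d}"
proof
  let ?g = "\<lambda>l\<in>{..<d}. \<epsilon> * of_int \<lfloor>s l / \<epsilon>\<rfloor>"
  have bound: "\<bar>s l\<bar> \<le> 1" if "l < d" for l
    using member_le_L2_set[of "{..<d}" l "\<lambda>l. \<bar>s l\<bar>"] that s by (simp add: L2_set_def)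
  have "\<lfloor>s l / \<epsilon>\<rfloor> \<in> {- \<lceil>1 / \<epsilon>\<rceil>..\<lceil>1 / \<epsilon>\<rceil>}" if "l < d" for l
  proof -
    have "- 1 / \<epsilon> \<le> s l / \<epsilon>" "s l / \<epsilon> \<le> 1 / \<epsilon>"
      using bound[OF that] \<epsilon> by (intro divide_right_mono; linarith)+
    then show ?thesis
      using floor_mono[of "- 1 / \<epsilon>" "s l / \<epsilon>"] floor_mono[of "s l / \<epsilon>" "1 / \<epsilon>"]
        floor_le_ceiling[of "1 / \<epsilon>"] by (auto simp: ceiling_def)
  qed
  then show "?g \<in> grid d \<epsilon>" by (auto simp: grid_def)
  show near: "\<bar>s l - ?g l\<bar> \<le> \<epsilon>" if "l < d" for l
  proof -
    have "of_int \<lfloor>s l / \<epsilon>\<rfloor> \<le> s l / \<epsilon>" "s l / \<epsilon> \<le> of_int \<lfloor>s l / \<epsilon>\<rfloor> + 1" by linarith+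
    then have "\<epsilon> * of_int \<lfloor>s l / \<epsilon>\<rfloor> \<le> \<epsilon> * (s l / \<epsilon>)"
      "\<epsilon> * (s l / \<epsilon>) \<le> \<epsilon> * (of_int \<lfloor>s l / \<epsilon>\<rfloor> + 1)"
      using \<epsilon> by (intro mult_left_mono; simp)+
    moreover have "\<epsilon> * (s l / \<epsilon>) = s l" using \<epsilon> by simp
    ultimately have "\<epsilon> * of_int \<lfloor>s l / \<epsilon>\<rfloor> \<le> s l" "s l \<le> \<epsilon> * of_int \<lfloor>s l / \<epsilon>\<rfloor> + \<epsilon>"
      by (simp_all add: distrib_left)
    then show ?thesis using that by simp
  qed
  have "1 = L2_set (\<lambda>l. ?g l + (s l - ?g l)) {..<d}" using s by (simp del: restrict_apply)
  also have "\<dots> \<le> L2_set ?g {..<d} + L2_set (\<lambda>l. s l - ?g l) {..<d}"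
    by (rule L2_set_triangle_ineq)
  also have "L2_set (\<lambda>l. s l - ?g l) {..<d} \<le> (\<Sum>l<d. \<bar>s l - ?g l\<bar>)"
    by (rule L2_set_le_sum_abs)
  also have "\<dots> \<le> (\<Sum>l<d. \<epsilon>)" by (intro sum_mono near) auto
  also have "\<dots> \<le> 1 / 2" using \<epsilon> by simp
  finally show "1 / 2 \<le> L2_set ?g {..<d}" by linarith
qed

context gaussian_attack_field
begin

text \<open>
  With \<open>d = K * m\<close> and mesh \<open>\<epsilon> = \<Delta> / (96 * d)\<close>, a unit vector is rounded to a grid point of norm
  at least \<open>1 / 2\<close>. There the signed sum is at least \<open>\<gamma> * \<Delta> * T / 8\<close> unless a bad event occurs. The rounding error is at most
  \<open>\<epsilon> * K * 3 * \<gamma> * m * 2 * T = \<gamma> * \<Delta> * T / 16\<close>, half of that. Each of the two kinds of bad event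
  receives half of the failure probability.
\<close>

lemma uniform_lower_bound:
  assumes Km: "1 \<le> K" "1 \<le> m"
    and \<Delta>: "\<Delta> = 2 * (1 - p) ^ (K - 1) - 1" "0 < \<Delta>" "\<Delta> \<le> 1"
    and \<delta>: "0 < \<delta>" "\<delta> \<le> 1"
    and T: "2304 * real K / \<Delta>\<^sup>2 *
      ((real (K * m) + 1) * ln (288 * real (K * m) / \<Delta>) + ln (2 / \<delta>)) \<le> real T"
  obtains E where "E \<in> events" "1 - \<delta> \<le> prob E"
    "\<And>\<omega> s. \<omega> \<in> E \<Longrightarrow> L2_set s {..<K * m} = 1 \<Longrightarrow> \<gamma> * \<Delta> * real T / 16 \<le> signed_sum K T s \<omega>"
proof -
  define d where "d = K * m"
  \<comment> \<open>\<open>R = 3 / \<epsilon>\<close> bounds the number of grid values in each coordinate\<close>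
  define R where "R = 288 * real d / \<Delta>"
  define \<epsilon> where "\<epsilon> = \<Delta> / (96 * real d)"
  have Kd: "K \<le> d" "1 \<le> d" using Km by (auto simp: d_def)
  have dR: "288 * real d \<le> R"
    using \<Delta>(2,3) Kd unfolding R_def by (simp add: pos_le_divide_eq mult_left_le)
  have R: "288 \<le> R" "0 < R" "real K \<le> R" "R = 3 / \<epsilon>"
    using dR Kd \<Delta>(2,3) by (auto simp: R_def \<epsilon>_def)
  have \<epsilon>: "0 < \<epsilon>" "real d * \<epsilon> = \<Delta> / 96" "\<epsilon> \<le> 1 / 3"
    using \<Delta>(2,3) Kd R by (auto simp: \<epsilon>_def field_simps)
  define H where "H = (real d + 1) * ln R + ln (2 / \<delta>)"
  have lnR: "1 \<le> ln R"
    using R exp_le by (simp add: ln_ge_iff)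
  have ln\<delta>: "0 \<le> ln (2 / \<delta>)" using \<delta> by simp
  have H: "real d + 1 \<le> H" "ln (2 / \<delta>) \<le> H"
    using lnR ln\<delta> by (auto simp: H_def intro: add_increasing2 add_increasing mult_nonneg_nonneg)
  have TH: "2304 * real K / \<Delta>\<^sup>2 * H \<le> real T" using T by (simp add: H_def R_def d_def)
  have "real K * H \<le> 2304 * real K / \<Delta>\<^sup>2 * H"
  proof (rule mult_right_mono)
    have "\<Delta>\<^sup>2 \<le> 1" using \<Delta>(2,3) by (simp add: power_le_one)
    then have "real K * \<Delta>\<^sup>2 \<le> 2304 * real K" by (simp add: mult.commute mult_mono)
    then show "real K \<le> 2304 * real K / \<Delta>\<^sup>2" using \<Delta>(2) by (simp add: pos_le_divide_eq)
  qed (use H in simp)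
  then have KHT: "real K * H \<le> real T" using TH by simp
  have "real K * 1 \<le> real K * H" "1 * H \<le> real K * H"
    using H Km Kd by (auto intro!: mult_left_mono mult_right_mono)
  then have KT: "K \<le> T" and HT: "H \<le> real T" using KHT by auto
  \<comment> \<open>the \<open>T\<close> windows together contain the inputs of the times below \<open>N\<close>\<close>
  define N where "N = T + (K - 1)"
  have N: "real T \<le> real N" "real N \<le> 2 * real T" using KT by (auto simp: N_def)
  let ?S = "{g \<in> grid d \<epsilon>. 1 / 2 \<le> L2_set g {..<d}}"
  let ?B = "\<lambda>g. {\<omega> \<in> space M. signed_sum K T g \<omega> \<le> real T * (\<gamma> * L2_set g {..<K * m} * \<Delta> / 4)}"
  let ?C = "{\<omega> \<in> space M. 3 * (real N * real m) * \<gamma> \<le> input_mass N \<omega>}"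
  define bad where "bad = (\<Union>g\<in>?S. ?B g) \<union> ?C"
  have fin: "finite ?S" using finite_grid by simp
  have B: "?B g \<in> events" and C: "?C \<in> events" for g by measurable
  have bad: "bad \<in> events"
    unfolding bad_def by (intro sets.Un sets.finite_UN fin B C)
  have "prob bad \<le> prob (\<Union>g\<in>?S. ?B g) + prob ?C"
    unfolding bad_def by (intro measure_Un_le sets.finite_UN fin B C)
  moreover have "prob (\<Union>g\<in>?S. ?B g) \<le> \<delta> / 2"
  proof -
    let ?x = "(real T / (2 * real K)) * \<Delta>\<^sup>2 / 1152"
    have "prob (\<Union>g\<in>?S. ?B g) \<le> (\<Sum>g\<in>?S. prob (?B g))"
      by (intro finite_measure_subadditive_finite fin image_subsetI B)
    also have "\<dots> \<le> (\<Sum>g\<in>?S. real K * exp (- ?x))"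
      using signed_sum_lower_tail[OF Km(1) KT _ \<Delta>(1)] \<Delta>(2,3)
      by (intro sum_mono) (auto simp: d_def)
    also have "\<dots> = real (card ?S) * (real K * exp (- ?x))" by simp
    also have "\<dots> \<le> R ^ d * (R * exp (- ?x))"
    proof (intro mult_mono)
      have "real (card ?S) \<le> real (card (grid d \<epsilon>))"
        using finite_grid by (intro of_nat_mono card_mono) auto
      then show "real (card ?S) \<le> R ^ d"
        using card_grid_le[OF \<epsilon>(1,3), of d] R(4) by simp
    qed (use R in auto)
    also have "\<dots> = exp ((real d + 1) * ln R - ?x)"
    proof -
      have "(real d + 1) * ln R - ?x = real d * ln R + (ln R + - ?x)" by (simp add: distrib_right)
      then show ?thesis using R(2) by (simp only: exp_add exp_of_nat_mult exp_ln)
    qed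
    also have "\<dots> \<le> exp (- ln (2 / \<delta>))"
    proof -
      have "0 < 2304 * real K / \<Delta>\<^sup>2" using Km \<Delta>(2) by simp
      then have "H \<le> real T / (2304 * real K / \<Delta>\<^sup>2)"
        using TH by (simp only: pos_le_divide_eq mult.commute)
      also have "\<dots> = ?x" by simp
      finally have "H \<le> ?x" .
      then show ?thesis by (simp add: H_def)
    qed
    also have "\<dots> = \<delta> / 2" using \<delta> by (simp add: exp_minus)
    finally show ?thesis .
  qed
  moreover have "prob ?C \<le> \<delta> / 2"
  proof -
    have "ln (2 / \<delta>) * 1 \<le> real N * real m"
      using H HT N Km ln\<delta> by (intro mult_mono) auto
    then have "exp (- (real N * real m)) \<le> exp (- ln (2 / \<delta>))" by simp
    also have "\<dots> = \<delta> / 2" using \<delta> by (simp add: exp_minus)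
    finally show ?thesis using input_mass_upper_tail[of N] by linarith
  qed
  ultimately have pb: "prob bad \<le> \<delta>" by simp
  show thesis
  proof
    show "space M - bad \<in> events" using bad by simp
    show "1 - \<delta> \<le> prob (space M - bad)" using pb bad by (simp add: prob_compl)
    fix \<omega> s assume \<omega>: "\<omega> \<in> space M - bad" and s: "L2_set s {..<K * m} = 1"
    obtain g where g: "g \<in> grid d \<epsilon>" "\<And>l. l < d \<Longrightarrow> \<bar>s l - g l\<bar> \<le> \<epsilon>" "1 / 2 \<le> L2_set g {..<d}"
      using grid_approx[of \<epsilon> d s] \<epsilon> \<Delta>(2,3) s by (auto simp: d_def)
    have "\<gamma> * \<Delta> * real T / 8 = real T * (\<gamma> * (1 / 2) * \<Delta> / 4)" by simp
    also have "\<dots> \<le> real T * (\<gamma> * L2_set g {..<d} * \<Delta> / 4)"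
      using g(3) \<Delta>(2,3) \<gamma>_pos by (intro mult_left_mono divide_right_mono mult_right_mono) auto
    also have "\<dots> \<le> signed_sum K T g \<omega>"
      using \<omega> g unfolding bad_def d_def by auto
    finally have main: "\<gamma> * \<Delta> * real T / 8 \<le> signed_sum K T g \<omega>" .
    have "\<epsilon> * (real K * input_mass N \<omega>) \<le> \<epsilon> * (real K * (3 * (real (2 * T) * real m) * \<gamma>))"
    proof (intro mult_left_mono)
      have "input_mass N \<omega> \<le> 3 * (real N * real m) * \<gamma>"
        using \<omega> unfolding bad_def by auto
      also have "\<dots> \<le> 3 * (real (2 * T) * real m) * \<gamma>"
        using N \<gamma>_pos by (intro mult_right_mono mult_left_mono) auto
      finally show "input_mass N \<omega> \<le> 3 * (real (2 * T) * real m) * \<gamma>" .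
    qed (use \<epsilon> in auto)
    also have "\<dots> = 6 * (real d * \<epsilon>) * real T * \<gamma>" by (simp add: d_def)
    also have "\<dots> = \<gamma> * \<Delta> * real T / 16" using \<epsilon> by simp
    finally show "\<gamma> * \<Delta> * real T / 16 \<le> signed_sum K T s \<omega>"
      using main signed_sum_perturb[of K s g \<epsilon> \<omega> T] g(2) by (simp add: d_def N_def)
  qed
qed

end

section \<open>Absorbing constants into the horizon\<close>

text \<open>
  Absorbs the constants inside the logarithms of \<open>uniform_lower_bound\<close>. Any numerical constant is
  dominated by a multiple of \<open>ln (k * m / \<Delta>)\<close> once this is at least \<open>ln 2\<close>; for instance
  \<open>288 * 2 < 2 ^ 10\<close>. Otherwise
  \<open>k * m = 1\<close> and \<open>\<Delta> > 1 / 2\<close>, so \<open>k / \<Delta>\<^sup>2 \<le> 4\<close> and the constants are covered by the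
  absolute lower bound on \<open>T\<close>.
\<close>

lemma horizon_condition:
  fixes k m r T :: nat and \<Delta> \<delta> q :: real
  assumes km: "1 \<le> k" "1 \<le> m" "1 \<le> r" and \<Delta>: "\<Delta> = 1 - 2 * q" "0 < \<Delta>" "\<Delta> \<le> 1"
    and \<delta>: "0 < \<delta>" "\<delta> \<le> 1"
    and T: "320000 * time_bound k m r q \<delta> \<le> real T" "k * m = 1 \<Longrightarrow> 1200000 \<le> T"
  shows "2304 * real (2 * k) / \<Delta>\<^sup>2 *
      ((real (2 * k * m) + 1) * ln (288 * real (2 * k * m) / \<Delta>) + ln (2 / \<delta>)) \<le> real T"
proof -
  define L where "L = ln (real (k * m) / \<Delta>)"
  define D where "D = ln (real r / \<delta>)"
  define F where "F = real k / \<Delta>\<^sup>2"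
  have F: "0 < F" using km \<Delta> by (simp add: F_def)
  have km1: "1 \<le> real (k * m)" using km by (metis mult_le_mono nat_mult_1 of_nat_1 of_nat_mono)
  have D: "ln (1 / \<delta>) \<le> D" and "0 \<le> ln (1 / \<delta>)"
    using km \<delta> by (auto simp: D_def divide_right_mono)
  then have D0: "0 \<le> D" by (rule order_trans[rotated])
  have L: "0 \<le> L" using km1 \<Delta> by (simp add: L_def)
  have tb: "time_bound k m r q \<delta> = F * (real (k * m) * L + D)"
    by (simp add: time_bound_def F_def L_def D_def \<Delta>(1))
  have big: "ln (288 * real (2 * k * m) / \<Delta>) \<le> 10 * ln 2 + L"
  proof -
    have "ln (288 * real (2 * k * m) / \<Delta>) = ln (576 * (real (k * m) / \<Delta>))" by simp
    also have "\<dots> = ln 576 + L"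
      unfolding L_def by (rule ln_mult_pos) (use km1 \<Delta>(2) in \<open>auto intro: divide_pos_pos\<close>)
    also have "ln 576 \<le> ln ((2::real) ^ 10)" by simp
    also have "\<dots> = 10 * ln 2" by (subst ln_realpow) auto
    finally show ?thesis by simp
  qed
  have \<delta>2: "ln (2 / \<delta>) \<le> ln 2 + D"
    using D \<delta> ln_mult[of 2 "1 / \<delta>"] by simp
  have "(real (2 * k * m) + 1) * ln (288 * real (2 * k * m) / \<Delta>) + ln (2 / \<delta>)
      \<le> (3 * real (k * m)) * (10 * ln 2 + L) + (ln 2 + D)"
  proof (intro add_mono \<delta>2 mult_mono big)
    show "0 \<le> ln (288 * real (2 * k * m) / \<Delta>)"
      using km1 \<Delta> by (intro ln_ge_zero) (simp add: pos_le_divide_eq)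
  qed (use km1 in auto)
  then have "2304 * real (2 * k) / \<Delta>\<^sup>2 *
      ((real (2 * k * m) + 1) * ln (288 * real (2 * k * m) / \<Delta>) + ln (2 / \<delta>))
    \<le> 4608 * F * ((3 * real (k * m)) * (10 * ln 2 + L) + (ln 2 + D))"
    unfolding F_def using km by (auto intro!: mult_left_mono divide_right_mono)
  also have "\<dots> \<le> real T"
  proof (cases "ln 2 \<le> L")
    case True
    have *: "real (k * m) * ln 2 \<le> real (k * m) * L" "1 * ln 2 \<le> real (k * m) * L"
      using True km1 by (intro mult_mono; simp)+
    then have "(3 * real (k * m)) * (10 * ln 2 + L) + (ln 2 + D) \<le> 34 * (real (k * m) * L + D)"
    proof -
      have "(3 * real (k * m)) * (10 * ln 2 + L) = 30 * (real (k * m) * ln 2) + 3 * (real (k * m) * L)"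
        by (simp add: algebra_simps)
      moreover have "30 * P + 3 * Q + (ln 2 + D) \<le> 34 * (Q + D)" if "P \<le> Q" "ln 2 \<le> Q" for P Q
        using that D0 by (simp add: distrib_left)
      ultimately show ?thesis using *[unfolded mult_1] by metis
    qed
    then have "4608 * F * ((3 * real (k * m)) * (10 * ln 2 + L) + (ln 2 + D))
        \<le> 4608 * F * (34 * (real (k * m) * L + D))"
      using F by (intro mult_left_mono) auto
    also have "\<dots> \<le> 320000 * time_bound k m r q \<delta>"
      unfolding tb using F D0 L km1 by simp
    finally show ?thesis using T by simp
  next
    case False
    have lt: "real (k * m) / \<Delta> < 2"
      using False km1 \<Delta> unfolding L_def by (subst (asm) not_le, subst (asm) ln_less_cancel_iff) auto
    moreover have "real (k * m) \<le> real (k * m) / \<Delta>"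
      using \<Delta> km1 by (simp add: pos_le_divide_eq mult_left_le)
    ultimately have "real (k * m) < 2" by linarith
    then have one: "k * m = 1" using km1 by linarith
    then have k1: "k = 1" "m = 1" by auto
    have "1 / 2 < \<Delta>" using lt one \<Delta> by (simp add: pos_divide_less_eq)
    then have quarter: "1 / 4 \<le> \<Delta>\<^sup>2"
      using power_mono[of "1 / 2" \<Delta> 2] by (simp add: power_divide)
    have "F * (1 / 4) \<le> F * \<Delta>\<^sup>2" using quarter F by (intro mult_left_mono) simp_all
    also have "F * \<Delta>\<^sup>2 = 1" using \<Delta>(2) by (simp add: F_def k1)
    finally have F4: "F \<le> 4" by simp
    define a b c where "a = F * ln 2" and "b = F * L" and "c = F * D"
    have "a \<le> 4 * 1"
      unfolding a_def using F4 F ln_2_less_1 by (intro mult_mono) simp_all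
    moreover have "0 \<le> b" "0 \<le> c" using F D0 L by (simp_all add: b_def c_def)
    moreover have "1200000 \<le> real T" using T(2)[OF one] by simp
    moreover have "320000 * b + 320000 * c \<le> real T"
      using T(1) unfolding tb one b_def c_def by (simp only: distrib_left of_nat_1 mult_1)
    ultimately have "142848 * a + 13824 * b + 4608 * c \<le> real T" by linarith
    moreover have "4608 * F * (3 * real (k * m) * (10 * ln 2 + L) + (ln 2 + D))
        = 142848 * a + 13824 * b + 4608 * c"
      unfolding one a_def b_def c_def by (simp add: algebra_simps)
    ultimately show ?thesis by (simp only:)
  qed
  finally show ?thesis .
qed

section \<open>Independence of the inputs and the indicators\<close>

lemma space_vec_borel [simp]: "space (vec_borel d) = carrier_vec d"
  by (simp add: vec_borel_def)

lemma measurable_vec_index: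
  assumes "i < d"
  shows "(\<lambda>v. v $ i) \<in> borel_measurable (vec_borel d)"
proof -
  have "(\<lambda>v. \<lambda>i\<in>{..<d}. v $ i) \<in> measurable (vec_borel d) (PiM {..<d} (\<lambda>_. borel))"
    unfolding vec_borel_def by (rule measurable_vimage_algebra1) (auto simp: space_PiM)
  then have "(\<lambda>v. (\<lambda>i\<in>{..<d}. v $ i) i) \<in> borel_measurable (vec_borel d)"
    by (rule measurable_compose) (use assms in \<open>auto intro: measurable_component_singleton\<close>)
  then show ?thesis using assms by simp
qed

lemma measurable_vec_coords:
  "(\<lambda>v. \<lambda>i\<in>{..<d}. v $ i) \<in> measurable (vec_borel d) (PiM {..<d} (\<lambda>_. borel))"
  by (intro measurable_restrict measurable_vec_index) simp

lemma measurable_vec: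
  "vec d \<in> measurable (PiM {..<d} (\<lambda>_. borel)) (vec_borel d)"
  unfolding vec_borel_def
proof (rule measurable_vimage_algebra2)
  show "(\<lambda>f. \<lambda>i\<in>{..<d}. vec d f $ i)
    \<in> measurable (PiM {..<d} (\<lambda>_. borel)) (PiM {..<d} (\<lambda>_. borel :: real measure))"
  proof (rule measurable_restrict)
    fix i assume i: "i \<in> {..<d}"
    then have "(\<lambda>f. f i) \<in> borel_measurable (PiM {..<d} (\<lambda>_. borel :: real measure))"
      by (rule measurable_component_singleton)
    then show "(\<lambda>f. vec d f $ i) \<in> borel_measurable (PiM {..<d} (\<lambda>_. borel :: real measure))"
      using i by simp
  qed
qed auto

context prob_space
begin

lemma indep_vars_prob_Ball:
  assumes "indep_vars N Y I" "finite J" "J \<subseteq> I" "\<And>j. j \<in> J \<Longrightarrow> S j \<in> sets (N j)"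
  shows "prob {\<omega> \<in> space M. \<forall>j\<in>J. Y j \<omega> \<in> S j} = (\<Prod>j\<in>J. prob {\<omega> \<in> space M. Y j \<omega> \<in> S j})"
proof (cases "J = {}")
  case True
  then show ?thesis by (simp add: prob_space)
next
  case False
  have "{\<omega> \<in> space M. \<forall>j\<in>J. Y j \<omega> \<in> S j} = (\<Inter>j\<in>J. Y j -` S j \<inter> space M)"
    using False by auto
  moreover have "Y j -` S j \<inter> space M = {\<omega> \<in> space M. Y j \<omega> \<in> S j}" for j by auto
  ultimately show ?thesis using indep_varsD[OF assms(1) False assms(2-4)] by simp
qed

text \<open>
  Together with \<open>indep_vars_prob_Ball\<close>, a description of independence by probabilities of boxes that
  treats the empty index set uniformly, which makes regrouping of finite index sets painless.
\<close>

lemma indep_varsI_prob_Ball: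
  assumes rv: "\<And>i. i \<in> I \<Longrightarrow> Y i \<in> measurable M (N i)"
    and prod: "\<And>J S. finite J \<Longrightarrow> J \<subseteq> I \<Longrightarrow> (\<And>j. j \<in> J \<Longrightarrow> S j \<in> sets (N j)) \<Longrightarrow>
      prob {\<omega> \<in> space M. \<forall>j\<in>J. Y j \<omega> \<in> S j} = (\<Prod>j\<in>J. prob {\<omega> \<in> space M. Y j \<omega> \<in> S j})"
  shows "indep_vars N Y I"
  unfolding indep_vars_def2
proof (intro conjI ballI rv indep_setsI)
  fix E J assume J: "J \<noteq> {}" "J \<subseteq> I" "finite J"
    and "\<forall>j\<in>J. E j \<in> {Y j -` A \<inter> space M |A. A \<in> sets (N j)}"
  then have "\<forall>j\<in>J. \<exists>A. A \<in> sets (N j) \<and> E j = Y j -` A \<inter> space M" by blast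
  then obtain S where S: "\<And>j. j \<in> J \<Longrightarrow> S j \<in> sets (N j)" "\<And>j. j \<in> J \<Longrightarrow> E j = Y j -` S j \<inter> space M"
    by metis
  have "(\<Inter>j\<in>J. E j) = {\<omega> \<in> space M. \<forall>j\<in>J. Y j \<omega> \<in> S j}" using S(2) J(1) by auto
  moreover have "prob (E j) = prob {\<omega> \<in> space M. Y j \<omega> \<in> S j}" if "j \<in> J" for j
    by (rule arg_cong[where f = prob]) (use S(2)[OF that] in auto)
  ultimately show "prob (\<Inter>j\<in>J. E j) = (\<Prod>j\<in>J. prob (E j))"
    using prod[OF J(3,2), of S] S(1) by (metis (no_types, lifting) prod.cong)
qed (use rv in \<open>auto intro: measurable_sets\<close>)

text \<open>
  The joint law of the entries is the product of normal laws, because the coordinate map undoes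
  \<open>vec d\<close>. Marginals and independence are both read off from it.
\<close>

lemma isotropic_gaussian_entries:
  assumes V: "V \<in> measurable M (vec_borel d)" "distr M (vec_borel d) V = isotropic_gaussian d \<sigma>"
    and \<sigma>: "0 < \<sigma>"
  shows "i < d \<Longrightarrow> distributed M lborel (\<lambda>\<omega>. V \<omega> $ i) (normal_density 0 \<sigma>)"
    and "indep_vars (\<lambda>_. borel) (\<lambda>i \<omega>. V \<omega> $ i) {..<d}"
proof -
  let ?N = "density lborel (\<lambda>z. ennreal (normal_density 0 \<sigma> z))"
  let ?P = "PiM {..<d} (\<lambda>_. ?N)" and ?B = "PiM {..<d} (\<lambda>_. borel :: real measure)"
  let ?c = "\<lambda>v. \<lambda>i\<in>{..<d}. v $ i"
  interpret N: prob_space ?N using \<sigma> by (rule prob_space_normal_density)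
  have sets: "sets ?P = sets ?B" by (intro sets_PiM_cong) auto
  have rv: "(\<lambda>\<omega>. V \<omega> $ i) \<in> borel_measurable M" if "i < d" for i
    by (rule measurable_compose[OF V(1) measurable_vec_index[OF that]])
  have "distr M ?B (\<lambda>\<omega>. ?c (V \<omega>)) = distr (distr M (vec_borel d) V) ?B ?c"
    using V(1) measurable_vec_coords[of d] by (simp add: distr_distr comp_def)
  also have "\<dots> = distr ?P ?B (\<lambda>f. ?c (vec d f))"
    unfolding V(2) isotropic_gaussian_def
    using measurable_vec[of d] measurable_vec_coords[of d]
    by (subst distr_distr) (auto simp: comp_def measurable_cong_sets[OF sets refl])
  also have "\<dots> = distr ?P ?P (\<lambda>f. f)"
  proof (rule distr_cong[OF refl sets[symmetric]])
    fix f assume "f \<in> space ?P"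
    then have "f \<in> extensional {..<d}" by (auto simp: space_PiM PiE_def)
    then show "?c (vec d f) = f" by (auto simp: extensional_def)
  qed
  also have "\<dots> = ?P" by (simp add: distr_id)
  finally have joint: "distr M ?B (\<lambda>\<omega>. ?c (V \<omega>)) = ?P" .
  have entry: "distr M borel (\<lambda>\<omega>. V \<omega> $ i) = ?N" if "i < d" for i
  proof -
    have "distr M borel (\<lambda>\<omega>. V \<omega> $ i) = distr (distr M ?B (\<lambda>\<omega>. ?c (V \<omega>))) borel (\<lambda>f. f i)"
      using that measurable_compose[OF V(1) measurable_vec_coords]
      by (subst distr_distr) (auto simp: comp_def intro: measurable_component_singleton)
    also have "\<dots> = distr ?P ?N (\<lambda>f. f i)"
      unfolding joint by (rule distr_cong) auto
    also have "\<dots> = ?N"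
      by (rule distr_PiM_component) (use that N.prob_space_axioms in auto)
    finally show ?thesis .
  qed
  show "distributed M lborel (\<lambda>\<omega>. V \<omega> $ i) (normal_density 0 \<sigma>)" if "i < d"
    unfolding distributed_def
  proof (intro conjI)
    show "distr M lborel (\<lambda>\<omega>. V \<omega> $ i) = ?N"
      using entry[OF that] by (metis distr_cong sets_lborel)
  qed (use rv[OF that] in auto)
  show "indep_vars (\<lambda>_. borel) (\<lambda>i \<omega>. V \<omega> $ i) {..<d}"
  proof (cases "d = 0")
    case True
    then show ?thesis by (simp add: indep_vars_def2 indep_sets_def)
  next
    case False
    have "PiM {..<d} (\<lambda>i. distr M borel (\<lambda>\<omega>. V \<omega> $ i)) = ?P"
      by (intro PiM_cong refl entry) auto
    then show ?thesis
      using False rv joint by (subst indep_vars_iff_distr_eq_PiM') auto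
  qed
qed

end

definition site :: "(nat \<Rightarrow> 'a \<Rightarrow> real vec) \<Rightarrow> (nat \<Rightarrow> 'a \<Rightarrow> bool) \<Rightarrow> nat \<times> nat option \<Rightarrow> 'a \<Rightarrow> real" where
  "site u \<xi> = (\<lambda>(t, c) \<omega>. case c of None \<Rightarrow> of_bool (\<xi> t \<omega>) | Some i \<Rightarrow> u t \<omega> $ i)"

lemma site_None [simp]: "site u \<xi> (t, None) \<omega> = of_bool (\<xi> t \<omega>)"
  and site_Some [simp]: "site u \<xi> (t, Some i) \<omega> = u t \<omega> $ i"
  by (simp_all add: site_def)

context attacked_system
begin

lemma measurable_input: "u t \<in> measurable M (vec_borel m)"
  and measurable_indicator: "\<xi> t \<in> measurable M (count_space UNIV)"
  using inputs_indep indicators_indep unfolding indep_vars_def2 by auto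

text \<open>
  Both factors are events of the sigma-algebras generated by the whole input sequence and the whole
  indicator sequence; inside each factor the variables are independent over time.
\<close>

lemma inputs_indicators_prob:
  assumes J: "finite JU" "finite JN"
    and sets: "\<And>t. t \<in> JU \<Longrightarrow> S t \<in> sets (vec_borel m)"
  shows "prob {\<omega> \<in> space M. (\<forall>t\<in>JU. u t \<omega> \<in> S t) \<and> (\<forall>t\<in>JN. \<xi> t \<omega> \<in> R t)}
    = (\<Prod>t\<in>JU. prob {\<omega> \<in> space M. u t \<omega> \<in> S t}) * (\<Prod>t\<in>JN. prob {\<omega> \<in> space M. \<xi> t \<omega> \<in> R t})"
proof -
  let ?PU = "PiM UNIV (\<lambda>_. vec_borel m)" and ?PN = "PiM UNIV (\<lambda>_. count_space UNIV :: bool measure)"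
  let ?EU = "{\<omega> \<in> space M. \<forall>t\<in>JU. u t \<omega> \<in> S t}" and ?EN = "{\<omega> \<in> space M. \<forall>t\<in>JN. \<xi> t \<omega> \<in> R t}"
  have "?EU \<in> sets (vimage_algebra (space M) (\<lambda>\<omega> t. u t \<omega>) ?PU)"
  proof -
    have "{f \<in> space ?PU. \<forall>t\<in>JU. f t \<in> S t} \<in> sets ?PU"
    proof (rule sets.sets_Collect_finite_All[OF _ J(1)])
      fix t assume "t \<in> JU"
      have "(\<lambda>f. f t) -` S t \<inter> space ?PU \<in> sets ?PU"
        by (rule measurable_sets[OF measurable_component_singleton[of t UNIV "\<lambda>_. vec_borel m"]
              sets[OF \<open>t \<in> JU\<close>]]) simp
      then show "{f \<in> space ?PU. f t \<in> S t} \<in> sets ?PU" by (simp add: vimage_def Int_def conj_commute)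
    qed
    then have "(\<lambda>\<omega> t. u t \<omega>) -` {f \<in> space ?PU. \<forall>t\<in>JU. f t \<in> S t} \<inter> space M
        \<in> sets (vimage_algebra (space M) (\<lambda>\<omega> t. u t \<omega>) ?PU)"
      by (rule in_vimage_algebra)
    moreover have "(\<lambda>\<omega> t. u t \<omega>) -` {f \<in> space ?PU. \<forall>t\<in>JU. f t \<in> S t} \<inter> space M = ?EU"
      using measurable_space[OF measurable_input] by (auto simp: space_PiM)
    ultimately show ?thesis by simp
  qed
  moreover have "?EN \<in> sets (vimage_algebra (space M) (\<lambda>\<omega> t. \<xi> t \<omega>) ?PN)"
  proof -
    have "{f \<in> space ?PN. \<forall>t\<in>JN. f t \<in> R t} \<in> sets ?PN"
    proof (rule sets.sets_Collect_finite_All[OF _ J(2)])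
      fix t
      have "(\<lambda>f. f t) -` R t \<inter> space ?PN \<in> sets ?PN"
        by (rule measurable_sets[OF measurable_component_singleton[of t UNIV "\<lambda>_. count_space UNIV"]]) auto
      then show "{f \<in> space ?PN. f t \<in> R t} \<in> sets ?PN" by (simp add: vimage_def Int_def conj_commute)
    qed
    then have "(\<lambda>\<omega> t. \<xi> t \<omega>) -` {f \<in> space ?PN. \<forall>t\<in>JN. f t \<in> R t} \<inter> space M
        \<in> sets (vimage_algebra (space M) (\<lambda>\<omega> t. \<xi> t \<omega>) ?PN)"
      by (rule in_vimage_algebra)
    moreover have "(\<lambda>\<omega> t. \<xi> t \<omega>) -` {f \<in> space ?PN. \<forall>t\<in>JN. f t \<in> R t} \<inter> space M = ?EN"
      by (auto simp: space_PiM)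
    ultimately show ?thesis by simp
  qed
  ultimately have "prob (?EU \<inter> ?EN) = prob ?EU * prob ?EN"
    by (rule indep_setD[OF inputs_indep_indicators])
  moreover have "?EU \<inter> ?EN = {\<omega> \<in> space M. (\<forall>t\<in>JU. u t \<omega> \<in> S t) \<and> (\<forall>t\<in>JN. \<xi> t \<omega> \<in> R t)}"
    by auto
  ultimately show ?thesis
    using indep_vars_prob_Ball[OF inputs_indep J(1), of S] sets
      indep_vars_prob_Ball[OF indicators_indep J(2), of R] by simp
qed

text \<open>
  Three layers of independence are combined: inputs against indicators, inputs and indicators over time,
  and the entries of one input among each other. A finite set of sites is split accordingly into its indicator sites and, for each time,
  its input entries.
\<close>

lemma site_indep: "indep_vars (\<lambda>_. borel) (site u \<xi>) (UNIV \<times> site_columns m)"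
proof (rule indep_varsI_prob_Ball)
  fix j assume "j \<in> (UNIV :: nat set) \<times> site_columns m"
  then obtain t c where j: "j = (t, c)" "c \<in> site_columns m" by auto
  show "site u \<xi> j \<in> borel_measurable M"
  proof (cases c)
    case None
    then show ?thesis
      using measurable_compose[OF measurable_indicator, of of_bool borel t]
      by (simp add: j(1) site_def)
  next
    case (Some i)
    then show ?thesis
      using j measurable_compose[OF measurable_input measurable_vec_index, of i t]
      by (simp add: site_def)
  qed
next
  fix J :: "(nat \<times> nat option) set" and S :: "nat \<times> nat option \<Rightarrow> real set"
  assume J: "finite J" "J \<subseteq> UNIV \<times> site_columns m" and S: "\<And>j. j \<in> J \<Longrightarrow> S j \<in> sets borel"
  define JN where "JN = {t. (t, None) \<in> J}"
  define JU where "JU = fst ` J"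
  define I where "I t = {i. (t, Some i) \<in> J}" for t
  define B where "B t = {v \<in> carrier_vec m. \<forall>i\<in>I t. v $ i \<in> S (t, Some i)}" for t
  \<comment> \<open>\<open>JU\<close> may contain times at which \<open>I t\<close> is empty; these contribute factors 1\<close>
  have fJN: "finite JN" by (rule finite_surj[OF J(1), of _ fst]) (force simp: JN_def)
  have fJU: "finite JU" using J(1) by (simp add: JU_def)
  have fI: "finite (I t)" for t
    by (rule finite_surj[OF J(1), of _ "\<lambda>j. the (snd j)"]) (force simp: I_def)
  have Im: "I t \<subseteq> {..<m}" for t using J(2) by (auto simp: I_def)
  have B: "B t \<in> sets (vec_borel m)" for t
  proof -
    have "{v \<in> space (vec_borel m). \<forall>i\<in>I t. v $ i \<in> S (t, Some i)} \<in> sets (vec_borel m)"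
    proof (rule sets.sets_Collect_finite_All[OF _ fI])
      fix i assume "i \<in> I t"
      then have "i < m" "S (t, Some i) \<in> sets borel" using Im S by (auto simp: I_def)
      then have "(\<lambda>v. v $ i) -` S (t, Some i) \<inter> space (vec_borel m) \<in> sets (vec_borel m)"
        by (intro measurable_sets[OF measurable_vec_index])
      then show "{v \<in> space (vec_borel m). v $ i \<in> S (t, Some i)} \<in> sets (vec_borel m)"
        by (simp add: vimage_def Int_def conj_commute)
    qed
    then show ?thesis by (simp add: B_def)
  qed
  have uB: "u t \<omega> \<in> B t \<longleftrightarrow> (\<forall>i\<in>I t. site u \<xi> (t, Some i) \<omega> \<in> S (t, Some i))" if "\<omega> \<in> space M" for t \<omega>
    using measurable_space[OF measurable_input that, of t] by (simp add: B_def)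
  have Jsplit: "J = (\<lambda>t. (t, None)) ` JN \<union> (\<lambda>(t, i). (t, Some i)) ` Sigma JU I"
  proof (intro equalityI subsetI)
    fix j assume j: "j \<in> J"
    show "j \<in> (\<lambda>t. (t, None)) ` JN \<union> (\<lambda>(t, i). (t, Some i)) ` Sigma JU I"
    proof (cases "snd j")
      case None
      then have "j = (fst j, None)" by (metis prod.collapse)
      then show ?thesis using j by (auto simp: JN_def)
    next
      case (Some i)
      then have ji: "j = (fst j, Some i)" by (metis prod.collapse)
      then have "(fst j, i) \<in> Sigma JU I" using j by (auto simp: JU_def I_def)
      then show ?thesis using ji by (auto intro!: image_eqI[of _ _ "(fst j, i)"])
    qed
  qed (auto simp: JN_def I_def)
  have all: "(\<forall>j\<in>J. P j) \<longleftrightarrow> (\<forall>t\<in>JN. P (t, None)) \<and> (\<forall>t\<in>JU. \<forall>i\<in>I t. P (t, Some i))" for P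
  proof
    assume R: "(\<forall>t\<in>JN. P (t, None)) \<and> (\<forall>t\<in>JU. \<forall>i\<in>I t. P (t, Some i))"
    show "\<forall>j\<in>J. P j"
    proof
      fix j assume "j \<in> J"
      then have "j \<in> (\<lambda>t. (t, None)) ` JN \<union> (\<lambda>(t, i). (t, Some i)) ` Sigma JU I"
        using Jsplit by (rule subst[rotated])
      then show "P j" using R by auto
    qed
  qed (auto simp: JN_def I_def)
  have "{\<omega> \<in> space M. \<forall>j\<in>J. site u \<xi> j \<omega> \<in> S j}
      = {\<omega> \<in> space M. (\<forall>t\<in>JU. u t \<omega> \<in> B t) \<and> (\<forall>t\<in>JN. \<xi> t \<omega> \<in> {b. of_bool b \<in> S (t, None)})}"
    unfolding all using uB by auto
  then have "prob {\<omega> \<in> space M. \<forall>j\<in>J. site u \<xi> j \<omega> \<in> S j}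
      = (\<Prod>t\<in>JU. prob {\<omega> \<in> space M. u t \<omega> \<in> B t}) *
        (\<Prod>t\<in>JN. prob {\<omega> \<in> space M. \<xi> t \<omega> \<in> {b. of_bool b \<in> S (t, None)}})"
    using inputs_indicators_prob[OF fJU fJN B, where R = "\<lambda>t. {b. of_bool b \<in> S (t, None)}"]
    by (simp only:)
  also have "\<dots> = (\<Prod>t\<in>JU. \<Prod>i\<in>I t. prob {\<omega> \<in> space M. site u \<xi> (t, Some i) \<omega> \<in> S (t, Some i)}) *
        (\<Prod>t\<in>JN. prob {\<omega> \<in> space M. site u \<xi> (t, None) \<omega> \<in> S (t, None)})"
  proof -
    have "prob {\<omega> \<in> space M. u t \<omega> \<in> B t}
        = (\<Prod>i\<in>I t. prob {\<omega> \<in> space M. site u \<xi> (t, Some i) \<omega> \<in> S (t, Some i)})" for t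
    proof -
      have "{\<omega> \<in> space M. u t \<omega> \<in> B t} = {\<omega> \<in> space M. \<forall>i\<in>I t. u t \<omega> $ i \<in> S (t, Some i)}"
        using uB by auto
      moreover have "S (t, Some i) \<in> sets borel" if "i \<in> I t" for i using S that by (simp add: I_def)
      ultimately show ?thesis
        using indep_vars_prob_Ball[OF isotropic_gaussian_entries(2)[OF measurable_input input_law \<gamma>_pos] fI Im,
            of t "\<lambda>i. S (t, Some i)"] by simp
    qed
    moreover have "{\<omega> \<in> space M. \<xi> t \<omega> \<in> {b. of_bool b \<in> S (t, None)}}
        = {\<omega> \<in> space M. site u \<xi> (t, None) \<omega> \<in> S (t, None)}" for t
      by (simp only: site_None mem_Collect_eq)
    ultimately show ?thesis by (simp only:)
  qed
  also have "\<dots> = (\<Prod>j\<in>J. prob {\<omega> \<in> space M. site u \<xi> j \<omega> \<in> S j})"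
  proof -
    let ?g = "\<lambda>j. prob {\<omega> \<in> space M. site u \<xi> j \<omega> \<in> S j}"
    have "(\<Prod>j\<in>J. ?g j) = (\<Prod>j\<in>(\<lambda>t. (t, None)) ` JN. ?g j) *
        (\<Prod>j\<in>(\<lambda>(t, i). (t, Some i)) ` Sigma JU I. ?g j)"
      by (subst Jsplit, rule prod.union_disjoint) (use fJN fJU fI in auto)
    also have "(\<Prod>j\<in>(\<lambda>t. (t, None)) ` JN. ?g j) = (\<Prod>t\<in>JN. ?g (t, None))"
      by (subst prod.reindex) (auto simp: inj_on_def)
    also have "(\<Prod>j\<in>(\<lambda>(t, i). (t, Some i)) ` Sigma JU I. ?g j) = (\<Prod>(t, i)\<in>Sigma JU I. ?g (t, Some i))"
      by (subst prod.reindex) (auto simp: inj_on_def intro!: prod.cong)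
    also have "\<dots> = (\<Prod>t\<in>JU. \<Prod>i\<in>I t. ?g (t, Some i))"
      using fJU fI by (subst prod.Sigma) auto
    finally show ?thesis by (simp only: mult.commute)
  qed
  finally show "prob {\<omega> \<in> space M. \<forall>j\<in>J. site u \<xi> j \<omega> \<in> S j}
      = (\<Prod>j\<in>J. prob {\<omega> \<in> space M. site u \<xi> j \<omega> \<in> S j})" .
qed

lemma gaussian_attack_field: "gaussian_attack_field M m p \<gamma> (site u \<xi>)"
proof
  show "indep_vars (\<lambda>_. borel) (site u \<xi>) (UNIV \<times> site_columns m)" by (rule site_indep)
  show "0 < \<gamma>" by (rule \<gamma>_pos)
  fix t
  have "1 - p = measure (measure_pmf (bernoulli_pmf p)) {False}"
    using p_prob by (simp add: measure_pmf_single)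
  also have "\<dots> = prob (\<xi> t -` {False} \<inter> space M)"
    unfolding indicator_law[of t, symmetric] by (rule measure_distr[OF measurable_indicator]) simp
  also have "\<xi> t -` {False} \<inter> space M = {\<omega> \<in> space M. site u \<xi> (t, None) \<omega> = 0}" by auto
  finally show "prob {\<omega> \<in> space M. site u \<xi> (t, None) \<omega> = 0} = 1 - p" by simp
  fix i assume "i < m"
  then have "distributed M lborel (\<lambda>\<omega>. u t \<omega> $ i) (normal_density 0 \<gamma>)"
    by (rule isotropic_gaussian_entries(1)[OF measurable_input input_law \<gamma>_pos])
  then show "distributed M lborel (site u \<xi> (t, Some i)) (normal_density 0 \<gamma>)"
    by (simp add: site_def)
qed

end

section \<open>From the attacked system to the field\<close>

text \<open>
  The window \<open>{a..<a + 2 * k}\<close> of the field corresponds to the time \<open>t = a + (2 * k - 1)\<close>, the last time of the window.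
\<close>

lemma scalar_prod_stacked_input:
  assumes "k \<ge> 1" "s \<in> carrier_vec (2 * k * m)"
  shows "s \<bullet> stacked_input m k u (a + (2 * k - 1)) \<omega>
    = window_form m (2 * k) (\<lambda>l. s $ l) a (\<lambda>i. site u \<xi> i \<omega>)"
  using assms
  by (simp add: scalar_prod_def stacked_input_def window_form_def atLeast0LessThan)

context attacked_system
begin

lemma attack_in_carrier: "\<omega> \<in> space M \<Longrightarrow> w t \<omega> \<in> carrier_vec n"
  using measurable_space[OF attacks] by simp

lemma accumulated_attack_entry:
  assumes "\<omega> \<in> space M" "i < r"
  shows "accumulated_attack r A C k w t \<omega> $ i
    = (\<Sum>j\<in>{0..2 * k - 2}. \<Sum>l<n. (C * A ^\<^sub>m j) $$ (i, l) * w (t - 1 - j) \<omega> $ l)"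
proof -
  have mat: "C * A ^\<^sub>m j \<in> carrier_mat r n" for j
    using A C by (intro mult_carrier_mat[OF C] pow_carrier_mat)
  have "accumulated_attack r A C k w t \<omega> $ i
      = (\<Sum>j\<in>{0..2 * k - 2}. ((C * A ^\<^sub>m j) *\<^sub>v w (t - 1 - j) \<omega>) $ i)"
    unfolding accumulated_attack_def
    by (rule index_finsum_vec)
      (use assms mat attack_in_carrier in \<open>auto intro!: mult_mat_vec_carrier\<close>)
  also have "\<dots> = (\<Sum>j\<in>{0..2 * k - 2}. \<Sum>l<n. (C * A ^\<^sub>m j) $$ (i, l) * w (t - 1 - j) \<omega> $ l)"
  proof (rule sum.cong[OF refl])
    fix j
    have "((C * A ^\<^sub>m j) *\<^sub>v w (t - 1 - j) \<omega>) $ i = row (C * A ^\<^sub>m j) i \<bullet> w (t - 1 - j) \<omega>"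
      using mat[of j] assms(2) by (intro index_mult_mat_vec) (simp only: carrier_matD)
    also have "\<dots> = (\<Sum>l<n. row (C * A ^\<^sub>m j) i $ l * w (t - 1 - j) \<omega> $ l)"
      unfolding scalar_prod_def carrier_vecD[OF attack_in_carrier[OF assms(1)]] atLeast0LessThan
      by (rule refl)
    also have "\<dots> = (\<Sum>l<n. (C * A ^\<^sub>m j) $$ (i, l) * w (t - 1 - j) \<omega> $ l)"
    proof (rule sum.cong[OF refl])
      fix l assume "l \<in> {..<n}"
      then have "row (C * A ^\<^sub>m j) i $ l = (C * A ^\<^sub>m j) $$ (i, l)"
        using mat[of j] assms(2) by (intro index_row(1)) (simp_all only: carrier_matD lessThan_iff)
      then show "row (C * A ^\<^sub>m j) i $ l * w (t - 1 - j) \<omega> $ l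
          = (C * A ^\<^sub>m j) $$ (i, l) * w (t - 1 - j) \<omega> $ l" by simp
    qed
    finally show "((C * A ^\<^sub>m j) *\<^sub>v w (t - 1 - j) \<omega>) $ i
      = (\<Sum>l<n. (C * A ^\<^sub>m j) $$ (i, l) * w (t - 1 - j) \<omega> $ l)" .
  qed
  finally show ?thesis .
qed

lemma measurable_accumulated_attack:
  assumes "i < r"
  shows "(\<lambda>\<omega>. accumulated_attack r A C k w t \<omega> $ i) \<in> borel_measurable M"
proof -
  have "(\<lambda>\<omega>. \<Sum>j\<in>{0..2 * k - 2}. \<Sum>l<n. (C * A ^\<^sub>m j) $$ (i, l) * w (t - 1 - j) \<omega> $ l)
      \<in> borel_measurable M"
    by (intro borel_measurable_sum borel_measurable_times borel_measurable_const
        measurable_compose[OF attacks measurable_vec_index]) simp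
  then show ?thesis
    using accumulated_attack_entry[OF _ assms] by (subst measurable_cong) auto
qed

text \<open>
  Without a firing indicator in the window, all the attack vectors in the accumulated attack are 0.
  Otherwise the left-hand side is the smaller of the two possible signs.
\<close>

lemma quiet_sign_le_sign_indicator:
  assumes "\<omega> \<in> space M" "i < r" "1 \<le> k"
  shows "quiet_sign (2 * k) a (\<lambda>j. site u \<xi> j \<omega>)
    \<le> sign_indicator (accumulated_attack r A C k w (a + (2 * k - 1)) \<omega> $ i = 0)"
proof (cases "\<forall>\<tau>\<in>{a..<a + (2 * k - 1)}. site u \<xi> (\<tau>, None) \<omega> = 0")
  case True
  have "w (a + (2 * k - 1) - 1 - j) \<omega> = 0\<^sub>v n" if "j \<in> {0..2 * k - 2}" for j
  proof (rule no_attack[OF assms(1)])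
    have "a + (2 * k - 1) - 1 - j \<in> {a..<a + (2 * k - 1)}" using that assms(3) by auto
    then show "\<not> \<xi> (a + (2 * k - 1) - 1 - j) \<omega>" using True by fastforce
  qed
  then have "accumulated_attack r A C k w (a + (2 * k - 1)) \<omega> $ i = 0"
    unfolding accumulated_attack_entry[OF assms(1,2)] by (intro sum.neutral ballI) simp
  then show ?thesis by (simp add: quiet_sign_def sign_indicator_def)
next
  case False
  then show ?thesis by (auto simp: quiet_sign_def sign_indicator_def)
qed

lemma scalar_prod_stacked_input_measurable:
  assumes "1 \<le> k" "dim_vec s = 2 * k * m"
  shows "(\<lambda>\<omega>. s \<bullet> stacked_input m k u t \<omega>) \<in> borel_measurable M"
proof -
  have "(\<lambda>\<omega>. \<Sum>l<2 * k * m. s $ l * u (t - l div m) \<omega> $ (l mod m)) \<in> borel_measurable M"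
    using dims
    by (intro borel_measurable_sum borel_measurable_times borel_measurable_const
        measurable_compose[OF measurable_input measurable_vec_index]) simp
  then show ?thesis
    by (simp add: scalar_prod_def stacked_input_def atLeast0LessThan)
qed

end

section \<open>Measurability of the event over all directions\<close>

lemma rational_approx:
  fixes x :: real
  shows "(\<lambda>j. of_int \<lfloor>x * real (Suc j)\<rfloor> / real (Suc j)) \<longlonglongrightarrow> x"
proof (rule LIMSEQ_I)
  fix e :: real assume "0 < e"
  then obtain N where N: "inverse (real (Suc N)) < e" using reals_Archimedean by blast
  have "norm (of_int \<lfloor>x * real (Suc j)\<rfloor> / real (Suc j) - x) < e" if "N \<le> j" for j
  proof -
    have "\<bar>of_int \<lfloor>x * real (Suc j)\<rfloor> - x * real (Suc j)\<bar> \<le> 1" by linarith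
    then have "\<bar>of_int \<lfloor>x * real (Suc j)\<rfloor> - x * real (Suc j)\<bar> / real (Suc j) \<le> 1 / real (Suc j)"
      by (rule divide_right_mono) simp
    also have "\<bar>of_int \<lfloor>x * real (Suc j)\<rfloor> - x * real (Suc j)\<bar> / real (Suc j)
        = \<bar>(of_int \<lfloor>x * real (Suc j)\<rfloor> - x * real (Suc j)) / real (Suc j)\<bar>"
      by (simp only: abs_divide abs_of_nat)
    also have "\<dots> = norm (of_int \<lfloor>x * real (Suc j)\<rfloor> / real (Suc j) - x)"
      by (simp add: diff_divide_distrib del: of_nat_Suc)
    also have "1 / real (Suc j) \<le> inverse (real (Suc N))" using that by (simp add: field_simps)
    finally show ?thesis using N by linarith
  qed
  then show "\<exists>no. \<forall>j\<ge>no. norm (of_int \<lfloor>x * real (Suc j)\<rfloor> / real (Suc j) - x) < e" by blast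
qed

lemma scalar_prod_tendsto:
  fixes v :: "real vec"
  assumes "\<And>l. l < dim_vec v \<Longrightarrow> (\<lambda>j. S j $ l) \<longlonglongrightarrow> s $ l"
  shows "(\<lambda>j. S j \<bullet> v) \<longlonglongrightarrow> s \<bullet> v"
  unfolding scalar_prod_def using assms by (intro tendsto_sum tendsto_mult tendsto_const) simp

text \<open>
  Both sides are continuous and positively homogeneous in the direction: a rational vector is scaled to the
  sphere, and a vector on the sphere is a limit of rational ones.
\<close>

lemma sphere_bound_iff_rational:
  fixes c :: "'t \<Rightarrow> real" and v :: "'t \<Rightarrow> real vec" and d :: nat and b :: real
  assumes v: "\<And>t. t \<in> I \<Longrightarrow> v t \<in> carrier_vec d"
  shows "(\<forall>s\<in>unit_sphere d. b \<le> (\<Sum>t\<in>I. c t * \<bar>s \<bullet> v t\<bar>)) \<longleftrightarrow>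
    (\<forall>f\<in>PiE {..<d} (\<lambda>_. \<rat>). b * L2_set f {..<d} \<le> (\<Sum>t\<in>I. c t * \<bar>vec d f \<bullet> v t\<bar>))"
    (is "?L \<longleftrightarrow> ?R")
proof
  assume L: ?L
  show ?R
  proof
    fix f :: "nat \<Rightarrow> real"
    define N where "N = L2_set f {..<d}"
    show "b * L2_set f {..<d} \<le> (\<Sum>t\<in>I. c t * \<bar>vec d f \<bullet> v t\<bar>)"
    proof (cases "N = 0")
      case True
      then have "\<forall>l<d. f l = 0" unfolding N_def by (subst (asm) L2_set_eq_0_iff) auto
      then have "vec d f \<bullet> v t = 0" if "t \<in> I" for t
        using v[OF that] by (auto simp: scalar_prod_def intro!: sum.neutral)
      then show ?thesis using True by (simp add: N_def)
    next
      case False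
      then have N: "0 < N" using L2_set_nonneg[of f "{..<d}"] unfolding N_def by linarith
      let ?s = "vec d (\<lambda>l. f l / N)"
      have "L2_set (\<lambda>l. ?s $ l) {..<d} = L2_set (\<lambda>l. (1 / N) * f l) {..<d}"
        by (rule L2_set_cong) auto
      also have "\<dots> = (1 / N) * N"
        unfolding N_def by (rule L2_set_right_distrib[symmetric]) (simp add: L2_set_nonneg)
      finally have "?s \<in> unit_sphere d" using N by (simp add: unit_sphere_def)
      then have "b \<le> (\<Sum>t\<in>I. c t * \<bar>?s \<bullet> v t\<bar>)" using L by blast
      also have "\<dots> = (\<Sum>t\<in>I. c t * \<bar>vec d f \<bullet> v t\<bar>) / N"
        unfolding sum_divide_distrib
      proof (rule sum.cong[OF refl])
        fix t assume "t \<in> I"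
        then have "?s \<bullet> v t = (vec d f \<bullet> v t) / N"
          using v[of t] unfolding scalar_prod_def sum_divide_distrib by (intro sum.cong) auto
        then show "c t * \<bar>?s \<bullet> v t\<bar> = c t * \<bar>vec d f \<bullet> v t\<bar> / N" using N by simp
      qed
      finally show ?thesis using N by (simp add: pos_le_divide_eq N_def)
    qed
  qed
next
  assume R: ?R
  show ?L
  proof
    fix s assume s: "s \<in> unit_sphere d"
    define q where "q j = (\<lambda>l\<in>{..<d}. of_int \<lfloor>s $ l * real (Suc j)\<rfloor> / real (Suc j))" for j
    have q: "q j \<in> PiE {..<d} (\<lambda>_. \<rat>)" for j by (auto simp: q_def)
    have lim: "(\<lambda>j. q j l) \<longlonglongrightarrow> s $ l" if "l < d" for l
      using rational_approx[of "s $ l"] that by (simp add: q_def)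
    have "(\<lambda>j. b * L2_set (q j) {..<d}) \<longlonglongrightarrow> b * L2_set (\<lambda>l. s $ l) {..<d}"
      unfolding L2_set_def by (intro tendsto_intros lim) auto
    moreover have "(\<lambda>j. \<Sum>t\<in>I. c t * \<bar>vec d (q j) \<bullet> v t\<bar>) \<longlonglongrightarrow> (\<Sum>t\<in>I. c t * \<bar>s \<bullet> v t\<bar>)"
    proof (intro tendsto_sum tendsto_mult tendsto_const tendsto_rabs scalar_prod_tendsto)
      fix t l assume "t \<in> I" "l < dim_vec (v t)"
      then have "l < d" using v[of t] by simp
      then show "(\<lambda>j. vec d (q j) $ l) \<longlonglongrightarrow> s $ l" using lim[of l] by simp
    qed
    ultimately have "b * L2_set (\<lambda>l. s $ l) {..<d} \<le> (\<Sum>t\<in>I. c t * \<bar>s \<bullet> v t\<bar>)"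
      by (rule LIMSEQ_le) (use R q in blast)
    then show "b \<le> (\<Sum>t\<in>I. c t * \<bar>s \<bullet> v t\<bar>)" using s by (simp add: unit_sphere_def)
  qed
qed

context attacked_system
begin

lemma sphere_event_measurable:
  assumes "1 \<le> k" "finite I"
  shows "{\<omega> \<in> space M. \<forall>s \<in> unit_sphere (2 * k * m). \<forall>i < r.
      (\<Sum>t\<in>I. sign_indicator (accumulated_attack r A C k w t \<omega> $ i = 0)
        * \<bar>s \<bullet> stacked_input m k u t \<omega>\<bar>) \<ge> b} \<in> events"
proof -
  let ?d = "2 * k * m" and ?Q = "PiE {..<2 * k * m} (\<lambda>_. \<rat> :: real set)"
  let ?c = "\<lambda>i t \<omega>. sign_indicator (accumulated_attack r A C k w t \<omega> $ i = 0)"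
  have Q: "countable ?Q" by (intro countable_PiE countable_rat) auto
  have "{\<omega> \<in> space M. \<forall>s \<in> unit_sphere ?d. \<forall>i < r.
      (\<Sum>t\<in>I. ?c i t \<omega> * \<bar>s \<bullet> stacked_input m k u t \<omega>\<bar>) \<ge> b}
    = {\<omega> \<in> space M. \<forall>i\<in>{..<r}. \<forall>f\<in>?Q.
      b * L2_set f {..<?d} \<le> (\<Sum>t\<in>I. ?c i t \<omega> * \<bar>vec ?d f \<bullet> stacked_input m k u t \<omega>\<bar>)}"
  proof (rule Collect_cong, rule conj_cong[OF refl])
    fix \<omega>
    have "(\<forall>s\<in>unit_sphere ?d. b \<le> (\<Sum>t\<in>I. ?c i t \<omega> * \<bar>s \<bullet> stacked_input m k u t \<omega>\<bar>)) \<longleftrightarrow>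
      (\<forall>f\<in>?Q. b * L2_set f {..<?d} \<le> (\<Sum>t\<in>I. ?c i t \<omega> * \<bar>vec ?d f \<bullet> stacked_input m k u t \<omega>\<bar>))" for i
      by (rule sphere_bound_iff_rational) (simp add: stacked_input_def)
    note rational = this
    have swap: "(\<forall>s\<in>S. \<forall>i<r. P s i) \<longleftrightarrow> (\<forall>i\<in>{..<r}. \<forall>s\<in>S. P s i)" for S and P :: "real vec \<Rightarrow> nat \<Rightarrow> bool"
      by auto
    show "(\<forall>s \<in> unit_sphere ?d. \<forall>i < r.
        (\<Sum>t\<in>I. ?c i t \<omega> * \<bar>s \<bullet> stacked_input m k u t \<omega>\<bar>) \<ge> b) \<longleftrightarrow>
      (\<forall>i\<in>{..<r}. \<forall>f\<in>?Q.
        b * L2_set f {..<?d} \<le> (\<Sum>t\<in>I. ?c i t \<omega> * \<bar>vec ?d f \<bullet> stacked_input m k u t \<omega>\<bar>))"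
      unfolding swap rational by (rule refl)
  qed
  also have "\<dots> \<in> events"
  proof (rule sets.sets_Collect_finite_All[OF sets.sets_Collect_countable_All'[OF _ Q]])
    fix i f assume "i \<in> {..<r}"
    then have acc: "(\<lambda>\<omega>. accumulated_attack r A C k w t \<omega> $ i) \<in> borel_measurable M" for t
      by (intro measurable_accumulated_attack) simp
    have sign: "(\<lambda>\<omega>. ?c i t \<omega>) \<in> borel_measurable M" for t
    proof -
      have "{\<omega> \<in> space M. accumulated_attack r A C k w t \<omega> $ i = 0} \<in> events"
        by (rule borel_measurable_eq[OF acc borel_measurable_const])
      then show ?thesis
        unfolding sign_indicator_def by (intro measurable_If borel_measurable_const)
    qed
    show "{\<omega> \<in> space M. b * L2_set f {..<?d}
        \<le> (\<Sum>t\<in>I. ?c i t \<omega> * \<bar>vec ?d f \<bullet> stacked_input m k u t \<omega>\<bar>)} \<in> events"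
      by (intro borel_measurable_le borel_measurable_const borel_measurable_sum borel_measurable_times
          borel_measurable_abs sign scalar_prod_stacked_input_measurable[OF assms(1)]) simp
  qed simp
  finally show ?thesis .
qed

section \<open>The lower bound for the attacked system\<close>

text \<open>
  Bernoulli's inequality gives \<open>(1 - p) ^ (2 * k - 1) \<ge> 1 - (2 * k - 1) * p > 1 / 2\<close>.
\<close>

lemma quiet_mean_bounds:
  assumes "1 \<le> k" "p < 1 / (4 * real k - 2)" "q = 1 - (1 - p) ^ (2 * k - 1)"
  shows "0 < 1 - 2 * q" "1 - 2 * q \<le> 1" "1 - 2 * q = 2 * (1 - p) ^ (2 * k - 1) - 1"
proof -
  show "1 - 2 * q = 2 * (1 - p) ^ (2 * k - 1) - 1" using assms(3) by simp
  have "(1 - p) ^ (2 * k - 1) \<le> 1" using p_prob by (intro power_le_one) auto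
  then show "1 - 2 * q \<le> 1" using assms(3) by simp
  have k: "real (2 * k - 1) = 2 * real k - 1" using assms(1) by simp
  have "p * (4 * real k - 2) < 1" using assms(1,2) by (simp add: pos_less_divide_eq)
  then have "real (2 * k - 1) * p < 1 / 2" unfolding k by (simp add: algebra_simps)
  moreover have "1 + real (2 * k - 1) * (- p) \<le> (1 + (- p)) ^ (2 * k - 1)"
    by (rule Bernoulli_inequality) (use p_prob in simp)
  ultimately show "0 < 1 - 2 * q" using assms(3) by simp
qed

text \<open>
  The constants are those of \<open>horizon_condition\<close> and \<open>uniform_lower_bound\<close> for \<open>K = 2 * k\<close>.
\<close>

lemma signed_excitation:
  assumes k: "1 \<le> k" and p: "p < 1 / (4 * real k - 2)" and q: "q = 1 - (1 - p) ^ (2 * k - 1)"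
    and \<delta>: "0 < \<delta>" "\<delta> \<le> 1"
    and T: "320000 * time_bound k m r q \<delta> \<le> real T" "k * m = 1 \<Longrightarrow> 1200000 \<le> T"
  shows "0 < 1 / 16 * (\<gamma> * (1 - 2 * q) * real T)"
    and "1 - \<delta> \<le> prob {\<omega> \<in> space M. \<forall>s \<in> unit_sphere (2 * k * m). \<forall>i < r.
      (\<Sum>t = 2 * k - 1 .. T + 2 * k - 2.
          sign_indicator (accumulated_attack r A C k w t \<omega> $ i = 0)
            * \<bar>s \<bullet> stacked_input m k u t \<omega>\<bar>)
        \<ge> 1 / 16 * (\<gamma> * (1 - 2 * q) * real T)}" (is "_ \<le> prob ?G")
proof -
  interpret field: gaussian_attack_field M m p \<gamma> "site u \<xi>" by (rule gaussian_attack_field)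
  note \<Delta> = quiet_mean_bounds[OF k p q]
  have horizon: "2304 * real (2 * k) / (1 - 2 * q)\<^sup>2 *
      ((real (2 * k * m) + 1) * ln (288 * real (2 * k * m) / (1 - 2 * q)) + ln (2 / \<delta>)) \<le> real T"
    by (rule horizon_condition[OF k dims(2,3) refl \<Delta>(1,2) \<delta> T])
  obtain E where E: "E \<in> events" "1 - \<delta> \<le> prob E"
    and bound: "\<And>\<omega> s. \<omega> \<in> E \<Longrightarrow> L2_set s {..<2 * k * m} = 1 \<Longrightarrow>
      \<gamma> * (1 - 2 * q) * real T / 16 \<le> field.signed_sum (2 * k) T s \<omega>"
    using field.uniform_lower_bound[OF _ dims(2) \<Delta>(3,1,2) \<delta> horizon] k by auto
  have "0 < real T"
  proof (rule less_le_trans[OF _ horizon])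
    have "1 \<le> 2 * k * m" using k dims(2) by (simp add: Suc_le_eq)
    then have "real 1 \<le> real (2 * k * m)" by (rule of_nat_mono)
    then have "1 < 288 * real (2 * k * m) / (1 - 2 * q)"
      using \<Delta>(1,2) by (simp add: pos_less_divide_eq)
    then have "0 < (real (2 * k * m) + 1) * ln (288 * real (2 * k * m) / (1 - 2 * q))"
      by (intro mult_pos_pos ln_gt_zero add_nonneg_pos of_nat_0_le_iff) simp_all
    moreover have "0 \<le> ln (2 / \<delta>)" using \<delta> by simp
    ultimately have "0 < (real (2 * k * m) + 1) * ln (288 * real (2 * k * m) / (1 - 2 * q)) + ln (2 / \<delta>)"
      by (rule add_pos_nonneg)
    moreover have "0 < 2304 * real (2 * k) / (1 - 2 * q)\<^sup>2" using k \<Delta>(1) by simp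
    ultimately show "0 < 2304 * real (2 * k) / (1 - 2 * q)\<^sup>2 *
      ((real (2 * k * m) + 1) * ln (288 * real (2 * k * m) / (1 - 2 * q)) + ln (2 / \<delta>))"
      by (rule mult_pos_pos[rotated])
  qed
  then show "0 < 1 / 16 * (\<gamma> * (1 - 2 * q) * real T)" using \<Delta>(1) \<gamma>_pos by simp
  have "E \<subseteq> ?G"
  proof (intro subsetI CollectI conjI ballI allI impI)
    fix \<omega> assume \<omega>: "\<omega> \<in> E"
    then show sp: "\<omega> \<in> space M" using E(1) sets.sets_into_space by blast
    fix s i assume s: "s \<in> unit_sphere (2 * k * m)" and i: "i < r"
    let ?f = "\<lambda>t. sign_indicator (accumulated_attack r A C k w t \<omega> $ i = 0)
      * \<bar>s \<bullet> stacked_input m k u t \<omega>\<bar>"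
    have "{2 * k - 1..T + 2 * k - 2} = {0 + (2 * k - 1)..<T + (2 * k - 1)}"
      using k \<open>0 < real T\<close> by auto
    then have "(\<Sum>t = 2 * k - 1..T + 2 * k - 2. ?f t) = (\<Sum>a<T. ?f (a + (2 * k - 1)))"
      by (simp only: sum.shift_bounds_nat_ivl atLeast0LessThan)
    also have "\<dots> \<ge> field.signed_sum (2 * k) T (\<lambda>l. s $ l) \<omega>"
    proof (rule sum_mono)
      fix a
      have "s \<bullet> stacked_input m k u (a + (2 * k - 1)) \<omega>
          = window_form m (2 * k) (\<lambda>l. s $ l) a (\<lambda>i. site u \<xi> i \<omega>)"
        using s by (intro scalar_prod_stacked_input k) (simp add: unit_sphere_def)
      then show "quiet_sign (2 * k) a (\<lambda>i. site u \<xi> i \<omega>)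
          * \<bar>window_form m (2 * k) (\<lambda>l. s $ l) a (\<lambda>i. site u \<xi> i \<omega>)\<bar> \<le> ?f (a + (2 * k - 1))"
        using quiet_sign_le_sign_indicator[OF sp i k] by (simp add: mult_right_mono)
    qed
    also have "field.signed_sum (2 * k) T (\<lambda>l. s $ l) \<omega> \<ge> \<gamma> * (1 - 2 * q) * real T / 16"
      using bound[OF \<omega>, of "\<lambda>l. s $ l"] s by (simp add: unit_sphere_def)
    finally show "1 / 16 * (\<gamma> * (1 - 2 * q) * real T) \<le> (\<Sum>t = 2 * k - 1..T + 2 * k - 2. ?f t)"
      by simp
  qed
  moreover have "?G \<in> events" by (rule sphere_event_measurable[OF k]) simp
  ultimately have "prob E \<le> prob ?G" by (rule finite_measure_mono)
  then show "1 - \<delta> \<le> prob ?G" using E(2) by linarith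
qed

end

theorem theorem2:
  shows "\<exists>c1>0. \<exists>c2>0. \<exists>T0::nat.
    \<forall>(M :: 'a measure) n m r A B C D p \<gamma> x u w y \<xi> k q \<delta> T.
      attacked_system M n m r A B C D p \<gamma> x u w y \<xi> \<longrightarrow>
      1 \<le> k \<longrightarrow>
      p < 1 / (4 * real k - 2) \<longrightarrow>
      q = 1 - (1 - p) ^ (2 * k - 1) \<longrightarrow>
      0 < \<delta> \<longrightarrow> \<delta> \<le> 1 \<longrightarrow>
      real T \<ge> c1 * time_bound k m r q \<delta> \<longrightarrow>
      (k * m = 1 \<longrightarrow> T \<ge> T0) \<longrightarrow>
        0 < c2 * (\<gamma> * (1 - 2 * q) * real T) \<and>
        measure M {\<omega> \<in> space M. \<forall>s \<in> unit_sphere (2 * k * m). \<forall>i < r.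
          (\<Sum>t = 2 * k - 1 .. T + 2 * k - 2.
              sign_indicator (accumulated_attack r A C k w t \<omega> $ i = 0)
                * \<bar>s \<bullet> stacked_input m k u t \<omega>\<bar>)
            \<ge> c2 * (\<gamma> * (1 - 2 * q) * real T)} \<ge> 1 - \<delta>"
proof (rule exI[of _ 320000], rule conjI, simp, rule exI[of _ "1 / 16"], rule conjI, simp,
    rule exI[of _ 1200000], intro allI impI conjI)
  fix M :: "'a measure" and n m r A B C D p \<gamma> x u w y \<xi> k q \<delta> T
  assume sys: "attacked_system M n m r A B C D p \<gamma> x u w y \<xi>"
    and a: "1 \<le> k" "p < 1 / (4 * real k - 2)" "q = 1 - (1 - p) ^ (2 * k - 1)" "0 < \<delta>" "\<delta> \<le> 1"
      "320000 * time_bound k m r q \<delta> \<le> real T"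
    and T: "k * m = 1 \<longrightarrow> 1200000 \<le> T"
  interpret attacked_system M n m r A B C D p \<gamma> x u w y \<xi> by (rule sys)
  note result = signed_excitation[OF a T[rule_format]]
  show "0 < 1 / 16 * (\<gamma> * (1 - 2 * q) * real T)" by (rule result(1))
  show "1 - \<delta> \<le> prob {\<omega> \<in> space M. \<forall>s \<in> unit_sphere (2 * k * m). \<forall>i < r.
      (\<Sum>t = 2 * k - 1 .. T + 2 * k - 2.
          sign_indicator (accumulated_attack r A C k w t \<omega> $ i = 0)
            * \<bar>s \<bullet> stacked_input m k u t \<omega>\<bar>)
        \<ge> 1 / 16 * (\<gamma> * (1 - 2 * q) * real T)}" by (rule result(2))
qed

end
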